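(* For each $n$, let $\lambda=(\lambda_1,\ldots,\lambda_I)$ and $\mu=(\mu_1,\ldots,\mu_J)$ be two partitions of $n$ (depending on $n$) such that $I=o(n)$. Let $\sigma\in S_n$ be a permutation chosen uniformly at random from a fixed double coset in $S_\lambda\backslash S_n/S_\mu$. Let $W_n:=\frac{\mathrm{des}(\sigma)-\mu_n}{\sigma_n}$, where $\mu_n:=E(\mathrm{des}(\sigma))$ and $\sigma_n^2:=\mathrm{Var}(\mathrm{des}(\sigma))$. Then $$d_K(W_n,Z)\leq O(n^{-1/2}),$$ where $Z$ is a standard normal random variable, so that $W_n$ converges in distribution to $Z$ as $n\to\infty$.
   Context: A partition $\lambda=(\lambda_1,\ldots,\lambda_I)$ of $n$ satisfies $\lambda_1\ge\dots\ge\lambda_I>0$ and $\lambda_1+\dots+\lambda_I=n$. Its $\lambda_i$-block is $L_i=\{\lambda_1+\dots+\lambda_{i-1}+1,\ldots,\lambda_1+\dots+\lambda_i\}$; the $\mu_j$-block $M_j$ is defined analogously for $\mu=(\mu_1,\ldots,\mu_J)$. The parabolic subgroup $S_\lambda\cong S_{\lambda_1}\times\dots\times S_{\lambda_I}$ is the set of permutations in $S_n$ preserving each block $L_i$ (similarly $S_\mu$). For $\sigma\in S_n$, the contingency table $T(\sigma)$ is the $I\times J$ table whose entry $T_{ij}$ is the number of elements of $M_j$ occurring in the positions of $\sigma$ given by $L_i$, i.e. $T_{ij}=|\{p\in L_i:\sigma(p)\in M_j\}|$; it has row sums $\lambda$ and column sums $\mu$. The parabolic double cosets in $S_\lambda\backslash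 S_n/S_\mu$ are in bijection with the nonnegative integer tables with row sums $\lambda$ and column sums $\mu$; the double coset indexed by $T$ is the set of all $\sigma\in S_n$ with $T(\sigma)=T$. $\mathrm{des}(\sigma)$ is the number of descents of $\sigma$, i.e. of $i\in\{1,\ldots,n-1\}$ with $\sigma(i)>\sigma(i+1)$. $d_K(X,Y)=\sup_{x\in\mathbb{R}}|P(X\le x)-P(Y\le x)|$ is the Kolmogorov distance. $a_n=O(b_n)$ means there are positive constants $c,n_0$ with $a_n\le cb_n$ for all $n\ge n_0$. *)

theory Defs
  imports
    "HOL-Probability.Probability"
    "HOL-Combinatorics.Permutations"
    "HOL-Library.Landau_Symbols"
begin

definition is_partition :: "nat \<Rightarrow> nat list \<Rightarrow> bool" where
  "is_partition n lam \<longleftrightarrow>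
     sorted_wrt (\<ge>) lam \<and> (\<forall>k \<in> set lam. k > 0) \<and> sum_list lam = n"

text \<open>Parts are indexed from 0 (as list entries), whereas positions and values are 1, ..., n.\<close>

definition block :: "nat list \<Rightarrow> nat \<Rightarrow> nat set" where
  "block lam i = {sum_list (take i lam) + 1 .. sum_list (take (Suc i) lam)}"

definition parabolic :: "nat \<Rightarrow> nat list \<Rightarrow> (nat \<Rightarrow> nat) set" where
  "parabolic n lam =
     {u. u permutes {1..n} \<and> (\<forall>i < length lam. u ` block lam i = block lam i)}"

text \<open>
  The double coset of a permutation \<open>p\<close> for the parabolic subgroups of \<open>lam\<close> and \<open>mu\<close>.
  The blocks of \<open>lam\<close> are blocks of positions and those of \<open>mu\<close> are blocks of values, so with
  \<open>\<circ>\<close> being composition of functions the first subgroup multiplies on the right and the second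
  one on the left.  Equivalently, products in the symmetric group are read from left to right.
  Lemma \<open>double_coset_eq_contingency_table\<close> below confirms that this is the convention for which
  double cosets are the fibres of the contingency table.
\<close>

definition double_coset :: "nat \<Rightarrow> nat list \<Rightarrow> nat list \<Rightarrow> (nat \<Rightarrow> nat) \<Rightarrow> (nat \<Rightarrow> nat) set" where
  "double_coset n lam mu p = {v \<circ> p \<circ> u | u v. u \<in> parabolic n lam \<and> v \<in> parabolic n mu}"

definition double_cosets :: "nat \<Rightarrow> nat list \<Rightarrow> nat list \<Rightarrow> (nat \<Rightarrow> nat) set set" where
  "double_cosets n lam mu = {double_coset n lam mu p | p. p permutes {1..n}}"

definition contingency_table :: "nat list \<Rightarrow> nat list \<Rightarrow> (nat \<Rightarrow> nat) \<Rightarrow> nat \<Rightarrow> nat \<Rightarrow> nat" where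
  "contingency_table lam mu s i j = card {p \<in> block lam i. s p \<in> block mu j}"

definition des :: "nat \<Rightarrow> (nat \<Rightarrow> nat) \<Rightarrow> nat" where
  "des n s = card {i. 1 \<le> i \<and> i < n \<and> s i > s (i + 1)}"

definition des_mean :: "nat \<Rightarrow> (nat \<Rightarrow> nat) set \<Rightarrow> real" where
  "des_mean n D = measure_pmf.expectation (pmf_of_set D) (\<lambda>s. real (des n s))"

definition des_var :: "nat \<Rightarrow> (nat \<Rightarrow> nat) set \<Rightarrow> real" where
  "des_var n D = measure_pmf.variance (pmf_of_set D) (\<lambda>s. real (des n s))"

text \<open>
  The law of the standardised number of descents of a uniform random element of \<open>D\<close>.
  If the variance vanishes, division by zero makes this the point mass at 0.
\<close>

definition des_std_law :: "nat \<Rightarrow> (nat \<Rightarrow> nat) set \<Rightarrow> real measure" where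
  "des_std_law n D =
     distr (measure_pmf (pmf_of_set D)) borel
       (\<lambda>s. (real (des n s) - des_mean n D) / sqrt (des_var n D))"

definition kolmogorov_dist :: "real measure \<Rightarrow> real measure \<Rightarrow> real" where
  "kolmogorov_dist M N = (SUP x. \<bar>cdf M x - cdf N x\<bar>)"


lemma sum_list_take_mono:
  fixes lam :: "nat list"
  assumes "i \<le> j"
  shows "sum_list (take i lam) \<le> sum_list (take j lam)"
proof -
  have "take j lam = take i lam @ take (j - i) (drop i lam)"
    using assms by (metis le_add_diff_inverse take_add)
  then show ?thesis by simp
qed

lemma block_subset: "sum_list lam = n \<Longrightarrow> block lam i \<subseteq> {1..n}"
  using sum_list_take_mono[of "Suc i" "max (Suc i) (length lam)" lam]
  by (auto simp: block_def)

lemma block_unique: "x \<in> block lam i \<Longrightarrow> x \<in> block lam j \<Longrightarrow> i = j"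
proof (induction i j rule: linorder_wlog)
  case (le i j)
  then show ?case
    using sum_list_take_mono[of "Suc i" j lam] by (cases "i = j") (auto simp: block_def)
qed auto

lemma block_exists:
  assumes "sum_list lam = n" "x \<in> {1..n}"
  shows "\<exists>i < length lam. x \<in> block lam i"
proof -
  define k where "k = (LEAST k. x \<le> sum_list (take k lam))"
  have ex: "x \<le> sum_list (take (length lam) lam)" using assms by simp
  have k: "x \<le> sum_list (take k lam)" unfolding k_def by (rule LeastI[of "\<lambda>k. x \<le> sum_list (take k lam)", OF ex])
  have kl: "k \<le> length lam" unfolding k_def by (rule Least_le[of "\<lambda>k. x \<le> sum_list (take k lam)", OF ex])
  have "k \<noteq> 0" using k assms by (intro notI) simp
  then obtain i where i: "k = Suc i" by (cases k) auto
  have "\<not> x \<le> sum_list (take i lam)"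
    using not_less_Least[of i "\<lambda>k. x \<le> sum_list (take k lam)"] i unfolding k_def by auto
  then have "x \<in> block lam i" using k i by (auto simp: block_def)
  moreover have "i < length lam" using kl i by simp
  ultimately show ?thesis by blast
qed

lemma parabolic_mem_block_iff:
  assumes "v \<in> parabolic n mu" "j < length mu"
  shows "v x \<in> block mu j \<longleftrightarrow> x \<in> block mu j"
proof -
  have "inj v" "v ` block mu j = block mu j"
    using assms by (auto simp: parabolic_def permutes_inj)
  then show ?thesis using inj_image_mem_iff[of v x "block mu j"] by simp
qed

lemma parabolicI:
  assumes "sum_list mu = n" "v permutes {1..n}"
    and "\<And>x j. x \<in> {1..n} \<Longrightarrow> j < length mu \<Longrightarrow> x \<in> block mu j \<Longrightarrow> v x \<in> block mu j"
  shows "v \<in> parabolic n mu"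
proof -
  have "v ` block mu j = block mu j" if "j < length mu" for j
  proof (rule card_subset_eq)
    show "v ` block mu j \<subseteq> block mu j"
      using assms(3) that block_subset[OF assms(1)] by blast
    show "card (v ` block mu j) = card (block mu j)"
      by (intro card_image permutes_inj_on[OF assms(2)])
  qed (simp add: block_def)
  then show ?thesis using assms(2) by (simp add: parabolic_def)
qed

lemma double_coset_eq_contingency_table:
  assumes lam: "is_partition n lam" and mu: "is_partition n mu" and p: "p permutes {1..n}"
  shows "double_coset n lam mu p =
    {s. s permutes {1..n} \<and> (\<forall>i < length lam. \<forall>j < length mu.
          contingency_table lam mu s i j = contingency_table lam mu p i j)}"
    (is "?L = ?R")
proof (intro equalityI subsetI)
  fix s assume "s \<in> ?L"
  then obtain u v where u: "u \<in> parabolic n lam" and v: "v \<in> parabolic n mu"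
    and s: "s = v \<circ> p \<circ> u"
    by (auto simp: double_coset_def)
  have perms: "u permutes {1..n}" "v permutes {1..n}" using u v by (auto simp: parabolic_def)
  have "s permutes {1..n}" unfolding s by (intro permutes_compose perms p)
  moreover have "contingency_table lam mu s i j = contingency_table lam mu p i j"
    if "i < length lam" "j < length mu" for i j
  proof -
    have "u ` {x \<in> block lam i. s x \<in> block mu j} = {x \<in> block lam i. p x \<in> block mu j}"
    proof (intro equalityI subsetI)
      fix y assume "y \<in> {x \<in> block lam i. p x \<in> block mu j}"
      then have y: "y \<in> block lam i" "p y \<in> block mu j" by auto
      have "u ` block lam i = block lam i"
        using u that(1) by (simp add: parabolic_def)
      with y(1) obtain x where "x \<in> block lam i" "y = u x" by auto
      then show "y \<in> u ` {x \<in> block lam i. s x \<in> block mu j}"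
        using y parabolic_mem_block_iff[OF v that(2)] by (auto simp: s)
    qed (use parabolic_mem_block_iff[OF v that(2)] parabolic_mem_block_iff[OF u that(1)] in
          \<open>auto simp: s\<close>)
    then show ?thesis
      unfolding contingency_table_def
      using card_image[OF permutes_inj_on[OF perms(1)]] by metis
  qed
  ultimately show "s \<in> ?R" by blast
next
  fix s assume "s \<in> ?R"
  then have s: "s permutes {1..n}" and
    T: "\<And>i j. i < length lam \<Longrightarrow> j < length mu \<Longrightarrow>
          contingency_table lam mu s i j = contingency_table lam mu p i j"
    by auto
  have sl: "sum_list lam = n" and sm: "sum_list mu = n"
    using lam mu by (auto simp: is_partition_def)
  define K where "K = (\<lambda>lam x. THE i. i < length lam \<and> x \<in> block lam i)"
  have K: "K l x < length l \<and> x \<in> block l (K l x)" if "sum_list l = n" "x \<in> {1..n}" for l x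
    unfolding K_def by (rule theI') (use block_exists[OF that] block_unique in blast)
  have Keq: "K l x = i \<longleftrightarrow> x \<in> block l i" if "sum_list l = n" "x \<in> {1..n}" for l x i
    using K[OF that] block_unique by blast
  define f where "f = (\<lambda>t x. (K lam x, K mu (t x :: nat)))"
  have fib: "card {x \<in> {1..n}. f t x = (i, j)} = contingency_table lam mu t i j"
    if "t permutes {1..n}" for t i j
  proof -
    have "t x \<in> {1..n}" if "x \<in> {1..n}" for x
      using \<open>t permutes {1..n}\<close> that by (metis permutes_in_image)
    then have "{x \<in> {1..n}. f t x = (i, j)} = {x \<in> block lam i. t x \<in> block mu j}"
      using block_subset[OF sl, of i] Keq[OF sl] Keq[OF sm] unfolding f_def by blast
    then show ?thesis by (simp add: contingency_table_def)
  qed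
  have empty: "block l i = {}" if "\<not> i < length l" for l i
    using that by (simp add: block_def)
  have "image_mset (f s) (mset_set {1..n}) = image_mset (f p) (mset_set {1..n})"
  proof (rule multiset_eqI)
    fix c :: "nat \<times> nat"
    obtain i j where c: "c = (i, j)" by (cases c)
    have cnt: "count (image_mset (f t) (mset_set {1..n})) c = card {x \<in> {1..n}. f t x = c}" for t
      by (simp add: count_image_mset_eq_card_vimage)
    have "contingency_table lam mu s i j = contingency_table lam mu p i j"
    proof (cases "i < length lam \<and> j < length mu")
      case False
      then show ?thesis using empty by (auto simp: contingency_table_def)
    qed (use T in blast)
    then show "count (image_mset (f s) (mset_set {1..n})) c =
               count (image_mset (f p) (mset_set {1..n})) c"
      using cnt[of s] cnt[of p] fib[OF s, of i j] fib[OF p, of i j] c by simp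
  qed
  then obtain u where u: "u permutes {1..n}" and fu: "\<forall>x\<in>{1..n}. f s x = f p (u x)"
    using image_mset_eq_implies_permutes[of "{1..n}" "f s" "f p"] by auto
  define v where "v = s \<circ> inv u \<circ> inv p"
  have v: "v permutes {1..n}"
    unfolding v_def by (intro permutes_compose permutes_inv u p s)
  have ux: "u x \<in> {1..n}" if "x \<in> {1..n}" for x using u that by (metis permutes_in_image)
  have U: "u \<in> parabolic n lam"
  proof (rule parabolicI[OF sl u])
    fix x j assume "x \<in> {1..n}" "x \<in> block lam j"
    then show "u x \<in> block lam j" using fu ux Keq[OF sl] by (metis f_def prod.inject)
  qed
  have V: "v \<in> parabolic n mu"
  proof (rule parabolicI[OF sm v])
    fix y j assume y: "y \<in> {1..n}" "y \<in> block mu j"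
    define x where "x = inv u (inv p y)"
    have x: "x \<in> {1..n}" unfolding x_def
      using y(1) permutes_inv[OF u] permutes_inv[OF p] by (metis permutes_in_image)
    have pux: "p (u x) = y"
      unfolding x_def using u p by (simp add: permutes_inverses)
    have sx: "s x \<in> {1..n}" using s x by (metis permutes_in_image)
    have "K mu (s x) = K mu y" using fu x pux by (auto simp: f_def)
    then show "v y \<in> block mu j"
      using Keq[OF sm] y sx by (metis v_def x_def comp_apply)
  qed
  have "s = v \<circ> p \<circ> u"
    using u p by (auto simp: v_def fun_eq_iff permutes_inverses)
  then show "s \<in> ?L" using U V unfolding double_coset_def by blast
qed

end

theory Submission
  imports Defs "HOL-Real_Asymp.Real_Asymp"
begin

text \<open>
  Multiplying a uniformly random element \<open>\<sigma>\<close> of a double coset by a fixed element of either parabolic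
  subgroup does not change its law.  All randomness used below comes from two consequences.

  First, \<^emph>\<open>free swaps\<close>.  If the positions \<open>p-1, p, p+1, p+2\<close> lie in one row block, then exchanging
  \<open>\<sigma>(p)\<close> and \<open>\<sigma>(p+1)\<close> preserves the law of \<open>\<sigma>\<close> and changes the number of descents by \<open>-1\<close>, \<open>0\<close> or \<open>1\<close>.
  For positions \<open>p\<close> divisible by 3 the exchanges do not interfere, so twice the number of descents has
  the law of \<open>M + S\<^sub>K\<close>, where \<open>M\<close> and \<open>K\<close> are functions of \<open>\<sigma>\<close> and, given \<open>\<sigma>\<close>, \<open>S\<^sub>K\<close> is a sum of \<open>K\<close>
  independent fair signs (\<open>coin_decomposition\<close>).  Since the number of row blocks is \<open>o(n)\<close>, about \<open>n/3\<close>
  positions are available, and each is effective with probability at least \<open>1/3\<close>, so \<open>K\<close> has order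
  \<open>n\<close>.  By a quantitative de Moivre-Laplace theorem (\<open>coin_power_normal\<close>), \<open>S\<^sub>K\<close> may be replaced by a
  normal variable at the cost of \<open>O(K\<^sup>-\<^sup>1\<^sup>/\<^sup>2)\<close> in Kolmogorov distance.  This settles the only
  non-smooth part of the problem.

  Second, \<^emph>\<open>resampling\<close>.  Conditioned on the value of \<open>\<sigma>\<close> at one position \<open>q\<close>, the unconditioned law is
  recovered by one random transposition of positions and one of values (\<open>avg_move\<close>), that is, by
  changing \<open>\<sigma>\<close> at no more than three places.  Hence a function of few values of \<open>\<sigma>\<close> is nearly independent of any
  function that reacts mildly to such changes, whatever the interaction between the blocks.  For a sum
  of functions of windows of four consecutive positions, such as \<open>M\<close>, two rounds of this argument give
  the approximate integration by parts \<open>E (M - m) f(M) = Var(M) E f'(M) + O(n sup |f''|)\<close>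
  (\<open>stein_identity\<close>).

  It remains to see that \<open>E \<Phi>((z - M)/s)\<close>, with \<open>s\<^sup>2 = E K\<close>, agrees with \<open>\<Phi>((z - m)/(s\<^sup>2 + Var M)\<^sup>1\<^sup>/\<^sup>2)\<close> up
  to \<open>O(n/s\<^sup>3)\<close>.  Interpolating between the two by shrinking \<open>M\<close> to its mean while raising the variance of
  the normal smoothing, the derivative is the defect in the integration by parts for a Gaussian density
  (\<open>gaussian_smoothing_normal\<close>).  As \<open>s\<^sup>2\<close> has order \<open>n\<close>, all errors are \<open>O(n\<^sup>-\<^sup>1\<^sup>/\<^sup>2)\<close>, and the total
  variance \<open>s\<^sup>2 + Var M\<close> is exactly that of twice the number of descents.
\<close>

section \<open>The normal distribution function along curves\<close>

definition Phi :: "real \<Rightarrow> real" where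
  "Phi = cdf std_normal_distribution"

text \<open>
  The density of the centred normal law with variance \<open>\<tau>\<close>; as a function of \<open>(\<tau>, x)\<close> it is the heat kernel.
\<close>

definition gauss :: "real \<Rightarrow> real \<Rightarrow> real" where
  "gauss \<tau> x = exp (- x\<^sup>2 / (2 * \<tau>)) / sqrt (2 * pi * \<tau>)"

lemma Phi_nonneg: "0 \<le> Phi x" and Phi_le_1: "Phi x \<le> 1"
proof -
  interpret real_distribution std_normal_distribution by (rule real_dist_normal_dist)
  show "0 \<le> Phi x" "Phi x \<le> 1"
    unfolding Phi_def by (rule cdf_nonneg cdf_bounded_prob)+
qed

lemma gauss_1: "gauss 1 x = std_normal_density x"
  by (simp add: gauss_def std_normal_density_def)

lemma DERIV_Phi: "(Phi has_real_derivative gauss 1 x) (at x)"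
proof -
  define F where "F y = integral {x - 2..y} (gauss 1)" for y
  have cont: "continuous_on S (gauss 1)" for S
    unfolding gauss_def[abs_def] by (intro continuous_intros) auto
  have F: "(F has_real_derivative gauss 1 y) (at y)" if "x - 2 < y" "y < x + 2" for y
  proof -
    have "(F has_real_derivative gauss 1 y) (at y within {x - 2..x + 2})"
      unfolding F_def using that by (intro integral_has_real_derivative cont) auto
    moreover have "at y within {x - 2..x + 2} = at y" using that by (rule at_within_Icc_at)
    ultimately show ?thesis by (simp only:)
  qed
  have eq: "Phi y - Phi (x - 1) = F y - F (x - 1)" if "x - 1 < y" "y < x + 1" for y
  proof -
    have "Phi y - Phi (x - 1) = measure std_normal_distribution {x - 1<..y}"
      unfolding Phi_def
      by (rule finite_borel_measure.cdf_diff_eq[OF real_distribution.finite_borel_measure_M[OF real_dist_normal_dist]]) fact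
    also have "\<dots> = F y - F (x - 1)"
    proof -
      have "emeasure std_normal_distribution {x - 1<..y} =
          (\<integral>\<^sup>+ t. ennreal (gauss 1 t) * indicator {x - 1<..y} t \<partial>lborel)"
        by (subst emeasure_density) (auto simp: gauss_1)
      also have "\<dots> = (\<integral>\<^sup>+ t. ennreal (gauss 1 t) * indicator {x - 1..y} t \<partial>lborel)"
      proof (rule nn_integral_cong_AE)
        show "AE t in lborel. ennreal (gauss 1 t) * indicator {x - 1<..y} t =
            ennreal (gauss 1 t) * indicator {x - 1..y} t"
          using AE_lborel_singleton[of "x - 1"] by eventually_elim (simp add: indicator_def)
      qed
      also have "\<dots> = ennreal (F y - F (x - 1))"
      proof (rule nn_integral_FTC_Icc)
        show "gauss 1 \<in> borel_measurable borel" by (rule borel_measurable_continuous_onI[OF cont])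
        show "(F has_real_derivative gauss 1 t) (at t)" if "t \<in> {x - 1..y}" for t
          using that \<open>y < x + 1\<close> by (intro F) auto
      qed (use that in \<open>auto simp: gauss_def\<close>)
      finally have "measure std_normal_distribution {x - 1<..y} = enn2real (ennreal (F y - F (x - 1)))"
        by (simp add: measure_def)
      moreover have "F (x - 1) \<le> F y"
      proof (rule DERIV_nonneg_imp_nondecreasing[of "x - 1" y F])
        fix t assume "x - 1 \<le> t" "t \<le> y"
        then show "\<exists>d. (F has_real_derivative d) (at t) \<and> 0 \<le> d"
          using that by (intro exI[of _ "gauss 1 t"] conjI F) (auto simp: gauss_def)
      qed (use that in auto)
      ultimately show ?thesis by simp
    qed
    finally show ?thesis .
  qed
  have "((\<lambda>y. F y - F (x - 1) + Phi (x - 1)) has_real_derivative gauss 1 x) (at x)"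
    by (auto intro!: derivative_eq_intros F)
  moreover have "eventually (\<lambda>y. y \<in> {x - 1<..<x + 1}) (nhds x)"
    by (intro eventually_nhds_in_open) auto
  then have "eventually (\<lambda>y. F y - F (x - 1) + Phi (x - 1) = Phi y) (nhds x)"
    by eventually_elim (use eq in \<open>auto simp: algebra_simps\<close>)
  ultimately show ?thesis
    by (subst (asm) DERIV_cong_ev) auto
qed

text \<open>
  The function \<open>\<Phi>(x/\<tau>\<^sup>1\<^sup>/\<^sup>2)\<close> solves the heat equation.  It is differentiated along a curve \<open>(x(t), \<tau>(t))\<close>
  because the interpolations below move the argument and the variance simultaneously.
\<close>

lemma DERIV_Phi_curve:
  assumes x: "(x has_real_derivative x') (at t)" and \<tau>: "(\<tau> has_real_derivative \<tau>') (at t)"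
    and pos: "\<tau> t > 0"
  shows "((\<lambda>t. Phi (x t / sqrt (\<tau> t))) has_real_derivative
           gauss (\<tau> t) (x t) * (x' - x t * \<tau>' / (2 * \<tau> t))) (at t)"
proof -
  have "((\<lambda>t. x t / sqrt (\<tau> t)) has_real_derivative
      (x' * sqrt (\<tau> t) - x t * (\<tau>' * (inverse (sqrt (\<tau> t)) / 2))) / (sqrt (\<tau> t) * sqrt (\<tau> t))) (at t)"
    using pos by (auto intro!: derivative_eq_intros x \<tau>)
  from DERIV_chain2[OF DERIV_Phi this] show ?thesis
  proof (rule DERIV_cong)
    have sq: "(x t / sqrt (\<tau> t))\<^sup>2 = (x t)\<^sup>2 / \<tau> t"
      using pos by (simp add: power_divide)
    have "sqrt (2 * pi * \<tau> t) = sqrt (2 * pi) * sqrt (\<tau> t)"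
      by (simp add: real_sqrt_mult)
    then have g: "gauss 1 (x t / sqrt (\<tau> t)) = gauss (\<tau> t) (x t) * sqrt (\<tau> t)"
      using pos by (simp add: gauss_def sq field_simps)
    define r where "r = sqrt (\<tau> t)"
    have r: "r > 0" "\<tau> t = r * r" using pos by (simp_all add: r_def)
    show "gauss 1 (x t / sqrt (\<tau> t)) * ((x' * sqrt (\<tau> t) - x t * (\<tau>' * (inverse (sqrt (\<tau> t)) / 2))) /
         (sqrt (\<tau> t) * sqrt (\<tau> t))) = gauss (\<tau> t) (x t) * (x' - x t * \<tau>' / (2 * \<tau> t))"
      unfolding g unfolding r_def[symmetric] using r by (simp add: field_simps)
  qed
qed

lemma DERIV_gauss:
  assumes "\<tau> > 0"
  shows "((gauss \<tau>) has_real_derivative (- (x / \<tau>) * gauss \<tau> x)) (at x)"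
proof -
  have "((\<lambda>x. - x\<^sup>2 / (2 * \<tau>)) has_real_derivative - (x / \<tau>)) (at x)"
    using assms by (auto intro!: derivative_eq_intros)
  from DERIV_cdivide[OF DERIV_chain2[OF DERIV_exp this], of "sqrt (2 * pi * \<tau>)"] show ?thesis
    by (simp add: gauss_def[abs_def] mult.commute)
qed

lemma gauss_pos: "\<tau> > 0 \<Longrightarrow> gauss \<tau> x > 0"
  by (simp add: gauss_def)

text \<open>
  The inequality \<open>1 + u \<le> exp u\<close> with \<open>u = x\<^sup>2/(6\<tau>)\<close>, cubed: enough decay to absorb the polynomials of
  degree up to five in \<open>x\<close> that bounding the first three derivatives produces.
\<close>

lemma gauss_bound:
  assumes "\<tau> > 0"
  shows "gauss \<tau> x * (1 + x\<^sup>2 / (6 * \<tau>)) ^ 3 \<le> 1 / (2 * sqrt \<tau>)"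
proof -
  have "1 + x\<^sup>2 / (6 * \<tau>) \<le> exp (x\<^sup>2 / (6 * \<tau>))" by (rule exp_ge_add_one_self)
  then have "(1 + x\<^sup>2 / (6 * \<tau>)) ^ 3 \<le> exp (x\<^sup>2 / (6 * \<tau>)) ^ 3"
    using assms by (intro power_mono) auto
  also have "\<dots> = exp (x\<^sup>2 / (2 * \<tau>))"
    by (simp add: exp_of_nat_mult[symmetric])
  finally have "exp (- x\<^sup>2 / (2 * \<tau>)) * (1 + x\<^sup>2 / (6 * \<tau>)) ^ 3 \<le>
      exp (- x\<^sup>2 / (2 * \<tau>)) * exp (x\<^sup>2 / (2 * \<tau>))"
    by (intro mult_left_mono) auto
  also have "\<dots> = 1" by (simp add: exp_add[symmetric])
  finally have e: "exp (- x\<^sup>2 / (2 * \<tau>)) * (1 + x\<^sup>2 / (6 * \<tau>)) ^ 3 \<le> 1" .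
  have "sqrt 4 \<le> sqrt (2 * pi)" using pi_gt3 by (intro real_sqrt_le_mono) auto
  then have p: "2 * sqrt \<tau> \<le> sqrt (2 * pi * \<tau>)"
    using assms by (simp add: real_sqrt_mult)
  have "gauss \<tau> x * (1 + x\<^sup>2 / (6 * \<tau>)) ^ 3 =
      (exp (- x\<^sup>2 / (2 * \<tau>)) * (1 + x\<^sup>2 / (6 * \<tau>)) ^ 3) / sqrt (2 * pi * \<tau>)"
    by (simp add: gauss_def)
  also have "\<dots> \<le> 1 / (2 * sqrt \<tau>)"
    using e p assms by (intro frac_le) auto
  finally show ?thesis .
qed

lemma DERIV_gauss2:
  assumes "\<tau> > 0"
  shows "((\<lambda>x. - (x / \<tau>) * gauss \<tau> x) has_real_derivative (x\<^sup>2 / \<tau>\<^sup>2 - 1 / \<tau>) * gauss \<tau> x) (at x)"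
proof -
  have l: "((\<lambda>x. - (x / \<tau>)) has_real_derivative - 1 / \<tau>) (at x)"
    using assms by (auto intro!: derivative_eq_intros)
  show ?thesis
    by (rule DERIV_cong[OF DERIV_mult[OF l DERIV_gauss[OF assms]]])
      (simp add: power2_eq_square algebra_simps)
qed

lemma DERIV_gauss3:
  assumes "\<tau> > 0"
  shows "((\<lambda>x. (x\<^sup>2 / \<tau>\<^sup>2 - 1 / \<tau>) * gauss \<tau> x) has_real_derivative
           (3 * x / \<tau>\<^sup>2 - x ^ 3 / \<tau> ^ 3) * gauss \<tau> x) (at x)"
proof -
  have l: "((\<lambda>x. x\<^sup>2 / \<tau>\<^sup>2 - 1 / \<tau>) has_real_derivative 2 * x / \<tau>\<^sup>2) (at x)"
    using assms by (auto intro!: derivative_eq_intros simp: power2_eq_square)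
  show ?thesis
    by (rule DERIV_cong[OF DERIV_mult[OF l DERIV_gauss[OF assms]]])
      (simp add: power2_eq_square power3_eq_cube algebra_simps)
qed

text \<open>
  By scaling, the \<open>k\<close>-th derivative of the heat kernel has size \<open>\<tau>\<^sup>-\<^sup>(\<^sup>k\<^sup>+\<^sup>1\<^sup>)\<^sup>/\<^sup>2\<close>.  For the third derivative
  the decay in \<open>x\<close> is kept as well, since these bounds are later summed over a lattice of points \<open>x\<close>.
\<close>

lemma gauss_deriv_bounds:
  assumes "\<tau> > 0"
  shows "\<bar>x\<bar> * gauss \<tau> x \<le> 2"
    and "\<bar>(x\<^sup>2 / \<tau>\<^sup>2 - 1 / \<tau>) * gauss \<tau> x\<bar> \<le> 3 / (\<tau> * sqrt \<tau>)"
    and "\<bar>(3 * x / \<tau>\<^sup>2 - x ^ 3 / \<tau> ^ 3) * gauss \<tau> x\<bar> \<le> 54 / (\<tau> * (\<tau> + x\<^sup>2))"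
proof -
  define r where "r = sqrt \<tau>"
  have r: "r > 0" "\<tau> = r * r" using assms by (simp_all add: r_def)
  define u where "u = \<bar>x\<bar> / r"
  define w where "w = u\<^sup>2 / 6"
  have w0: "w \<ge> 0" by (simp add: w_def)
  have u0: "u \<ge> 0" using r by (simp add: u_def)
  have xu: "\<bar>x\<bar> = u * r" using r by (simp add: u_def)
  have "x\<^sup>2 = \<bar>x\<bar>\<^sup>2" by simp
  also have "\<dots> = u\<^sup>2 * (r * r)" unfolding xu power2_eq_square by (simp only: ac_simps)
  finally have x2: "x\<^sup>2 = 6 * w * \<tau>" using r by (simp add: w_def)
  have uw: "u \<le> (1 + 6 * w) / 2"
    using sum_squares_ge_zero[of "u - 1" 0] by (simp add: w_def power2_eq_square algebra_simps)
  have gb: "gauss \<tau> x * (1 + w) ^ 3 \<le> 1 / (2 * r)"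
    using gauss_bound[OF assms, of x] assms by (simp add: x2 r_def)
  have gp: "gauss \<tau> x > 0" using gauss_pos assms by blast
  have main: "a * gauss \<tau> x \<le> c * (1 / (2 * r))" if "a \<le> c * (1 + w) ^ 3" "c \<ge> 0" for a c
  proof -
    have "a * gauss \<tau> x \<le> c * (1 + w) ^ 3 * gauss \<tau> x"
      using that gp by (intro mult_right_mono) auto
    also have "\<dots> = c * (gauss \<tau> x * (1 + w) ^ 3)" by simp
    also have "\<dots> \<le> c * (1 / (2 * r))" using gb that by (intro mult_left_mono) auto
    finally show ?thesis .
  qed
  have p3: "(1 + w) ^ 3 = 1 + 3 * w + 3 * w\<^sup>2 + w ^ 3"
    by (simp add: power3_eq_cube power2_eq_square algebra_simps)
  have w3: "w ^ 3 \<ge> 0" "w\<^sup>2 \<ge> 0" using w0 by auto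
  define P where "P = (1 + w) ^ 3"
  have lin: "1 + 3 * w \<le> P" unfolding P_def p3 using w3 by simp
  have "u \<le> 4 * P" using uw w0 lin by (simp add: field_simps)
  then have "u * r * gauss \<tau> x \<le> 2"
    using main[of u 4] r unfolding P_def by (simp add: field_simps)
  then show "\<bar>x\<bar> * gauss \<tau> x \<le> 2" by (simp add: xu)
  have "\<bar>6 * w - 1\<bar> \<le> 6 * P" using w0 lin by simp
  from main[OF this[unfolded P_def]] have "\<bar>6 * w - 1\<bar> * gauss \<tau> x \<le> 3 / r" by simp
  then have "\<bar>6 * w - 1\<bar> * gauss \<tau> x / \<tau> \<le> 3 / r / \<tau>" using assms by (intro divide_right_mono) auto
  moreover have "x\<^sup>2 / \<tau>\<^sup>2 - 1 / \<tau> = (6 * w - 1) / \<tau>"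
    unfolding x2 using assms by (simp add: power2_eq_square field_simps)
  ultimately show "\<bar>(x\<^sup>2 / \<tau>\<^sup>2 - 1 / \<tau>) * gauss \<tau> x\<bar> \<le> 3 / (\<tau> * sqrt \<tau>)"
    using gp assms by (simp add: abs_mult r_def mult.commute)
  have "u * \<bar>3 - 6 * w\<bar> * (1 + 6 * w) \<le> (1 + 6 * w) / 2 * (3 + 6 * w) * (1 + 6 * w)"
    using uw w0 u0 by (intro mult_right_mono mult_mono) auto
  also have "\<dots> \<le> 108 * (1 + w) ^ 3"
    using w0 w3 unfolding p3 by (simp add: power3_eq_cube power2_eq_square field_simps)
  finally have "u * \<bar>3 - 6 * w\<bar> * (1 + 6 * w) * gauss \<tau> x \<le> 54 / r"
    using main[of "u * \<bar>3 - 6 * w\<bar> * (1 + 6 * w)" 108] by simp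
  then have *: "u * \<bar>3 - 6 * w\<bar> * gauss \<tau> x \<le> 54 / r / (1 + 6 * w)"
    using w0 by (subst pos_le_divide_eq) (auto simp: ac_simps)
  have x3: "x ^ 3 = x * (6 * w * \<tau>)" unfolding x2[symmetric] by (simp add: power3_eq_cube power2_eq_square)
  have "3 * x / \<tau>\<^sup>2 - x ^ 3 / \<tau> ^ 3 = x / \<tau>\<^sup>2 * (3 - 6 * w)"
    unfolding x3 using assms by (simp add: power2_eq_square power3_eq_cube field_simps)
  then have "\<bar>(3 * x / \<tau>\<^sup>2 - x ^ 3 / \<tau> ^ 3) * gauss \<tau> x\<bar> = (u * \<bar>3 - 6 * w\<bar> * gauss \<tau> x) * r / \<tau>\<^sup>2"
    using gp xu by (simp add: abs_mult)
  also have "\<dots> \<le> 54 / r / (1 + 6 * w) * r / \<tau>\<^sup>2"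
    using * r by (intro divide_right_mono mult_right_mono) auto
  also have "\<dots> = 54 / (\<tau> * (\<tau> + 6 * w * \<tau>))"
  proof -
    have "54 / r / (1 + 6 * w) * r / \<tau>\<^sup>2 = 54 / ((1 + 6 * w) * \<tau>\<^sup>2)" using r(1) by simp
    also have "(1 + 6 * w) * \<tau>\<^sup>2 = \<tau> * (\<tau> + 6 * w * \<tau>)" by (simp add: power2_eq_square algebra_simps)
    finally show ?thesis .
  qed
  finally show "\<bar>(3 * x / \<tau>\<^sup>2 - x ^ 3 / \<tau> ^ 3) * gauss \<tau> x\<bar> \<le> 54 / (\<tau> * (\<tau> + x\<^sup>2))"
    unfolding x2 .
qed

lemma deriv_bound_lipschitz:
  fixes G G' :: "real \<Rightarrow> real"
  assumes "\<And>x. (G has_real_derivative G' x) (at x)" "\<And>x. \<bar>G' x\<bar> \<le> B"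
  shows "\<bar>G u - G v\<bar> \<le> B * \<bar>u - v\<bar>"
proof -
  have less: "\<bar>G v - G u\<bar> \<le> B * \<bar>v - u\<bar>" if uv: "u < v" for u v
  proof -
    obtain \<xi> where "G v - G u = (v - u) * G' \<xi>" using MVT2[OF uv, of G G'] assms(1) by blast
    then have "\<bar>G v - G u\<bar> = \<bar>v - u\<bar> * \<bar>G' \<xi>\<bar>" by (simp add: abs_mult)
    also have "\<dots> \<le> \<bar>v - u\<bar> * B" using assms(2) by (intro mult_left_mono) auto
    finally show ?thesis by (simp add: mult.commute)
  qed
  show ?thesis
    using less[of u v] less[of v u] by (cases u v rule: linorder_cases) (auto simp: abs_minus_commute)
qed

lemma taylor_bound:
  fixes f f' :: "real \<Rightarrow> real"
  assumes d: "\<And>x. (f has_real_derivative f' x) (at x)" and l: "\<And>u v. \<bar>f' u - f' v\<bar> \<le> H * \<bar>u - v\<bar>"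
    and H: "H \<ge> 0" and uv: "\<bar>u - v\<bar> \<le> c"
  shows "\<bar>f u - f v - (u - v) * f' u\<bar> \<le> H * c\<^sup>2"
proof -
  have "\<exists>\<xi>. \<bar>u - \<xi>\<bar> \<le> \<bar>u - v\<bar> \<and> f u - f v = (u - v) * f' \<xi>"
  proof (cases u v rule: linorder_cases)
    case less
    then obtain \<xi> where "u < \<xi>" "\<xi> < v" "f v - f u = (v - u) * f' \<xi>" using MVT2[of u v f f'] d by blast
    then show ?thesis by (intro exI[of _ \<xi>]) (auto simp: algebra_simps)
  next
    case greater
    then obtain \<xi> where "v < \<xi>" "\<xi> < u" "f u - f v = (u - v) * f' \<xi>" using MVT2[of v u f f'] d by blast
    then show ?thesis by (intro exI[of _ \<xi>]) auto
  qed auto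
  then obtain \<xi> where \<xi>: "\<bar>u - \<xi>\<bar> \<le> \<bar>u - v\<bar>" "f u - f v = (u - v) * f' \<xi>" by blast
  have "\<bar>f' \<xi> - f' u\<bar> \<le> H * \<bar>\<xi> - u\<bar>" by (rule l)
  also have "\<dots> \<le> H * c" using \<xi>(1) uv H by (intro mult_left_mono) auto
  finally have "\<bar>u - v\<bar> * \<bar>f' \<xi> - f' u\<bar> \<le> c * (H * c)"
    using uv by (intro mult_mono) auto
  then show ?thesis unfolding \<xi>(2) right_diff_distrib[symmetric] abs_mult
    by (simp add: power2_eq_square ac_simps)
qed

section \<open>Repeated coin averages of a step function\<close>

text \<open>
  A fair sign has the same first three moments as a standard normal variable, so one coin average of
  \<open>\<Phi>(y/s\<^sup>1\<^sup>/\<^sup>2)\<close> differs from \<open>\<Phi>(y/(s+1)\<^sup>1\<^sup>/\<^sup>2)\<close> only by a fourth derivative in \<open>y\<close>, taken at a variance in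
  \<open>[s, s + 1]\<close> and at a point of \<open>[y - 1, y + 1]\<close>.
  Interpolating with signs of size \<open>t\<close> and normal variance \<open>1 - t\<^sup>2\<close> exhibits the cancellation.
\<close>

lemma heat_step:
  assumes s: "s \<ge> 1"
  shows "\<bar>(Phi ((y + 1) / sqrt s) + Phi ((y - 1) / sqrt s)) / 2 - Phi (y / sqrt (s + 1))\<bar>
           \<le> 162 / (s * (s + y\<^sup>2))"
proof -
  \<comment> \<open>a sign of size \<open>t\<close> and a normal variable of variance \<open>s + 1 - t\<^sup>2\<close>: total variance \<open>s + 1\<close> for every \<open>t\<close>\<close>
  define w where "w t = (Phi ((y + t) / sqrt (s + 1 - t\<^sup>2)) + Phi ((y - t) / sqrt (s + 1 - t\<^sup>2))) / 2" for t
  \<comment> \<open>\<open>k (s + 1 - t\<^sup>2) t\<close> is the derivative of \<open>w\<close> at \<open>t\<close>; with \<open>\<tau>\<close> frozen, its derivative in \<open>b\<close>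
    is a difference of second derivatives of the heat kernel\<close>
  define k where "k \<tau> b = (gauss \<tau> (y + b) * (1 + (y + b) * b / \<tau>) - gauss \<tau> (y - b) * (1 - (y - b) * b / \<tau>)) / 2"
    for \<tau> b :: real
  define g2 where "g2 \<tau> x = (x\<^sup>2 / \<tau>\<^sup>2 - 1 / \<tau>) * gauss \<tau> x" for \<tau> x
  have w': "(w has_real_derivative k (s + 1 - t\<^sup>2) t) (at t)" if "0 \<le> t" "t \<le> 1" for t
  proof -
    have "t * t \<le> 1 * 1" using that by (intro mult_mono) auto
    then have pos: "s + 1 - t\<^sup>2 > 0" using s by (simp add: power2_eq_square)
    have tau: "((\<lambda>t. s + 1 - t\<^sup>2) has_real_derivative - 2 * t) (at t)"
      by (auto intro!: derivative_eq_intros)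
    have a: "((\<lambda>t. y + t) has_real_derivative 1) (at t)" "((\<lambda>t. y - t) has_real_derivative - 1) (at t)"
      by (auto intro!: derivative_eq_intros)
    have eq: "(gauss T (y + t) * (1 - (y + t) * (- 2 * t) / (2 * T)) +
        gauss T (y - t) * (- 1 - (y - t) * (- 2 * t) / (2 * T))) / 2 = k T t" if "T > 0" for T
      using that by (simp add: k_def field_simps)
    show ?thesis unfolding w_def
      using DERIV_cdivide[OF DERIV_add[OF DERIV_Phi_curve[OF a(1) tau pos] DERIV_Phi_curve[OF a(2) tau pos]], of 2]
      unfolding eq[OF pos] .
  qed
  obtain t where t: "0 < t" "t < 1" "w 1 - w 0 = k (s + 1 - t\<^sup>2) t"
    using MVT2[of 0 1 w "\<lambda>t. k (s + 1 - t\<^sup>2) t"] w' by auto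
  define \<tau> where "\<tau> = s + 1 - t\<^sup>2"
  have "t\<^sup>2 \<le> 1" using t by (simp add: power_le_one)
  then have \<tau>: "\<tau> \<ge> s" "\<tau> > 0" using s by (auto simp: \<tau>_def)
  have k': "(k \<tau> has_real_derivative - b * (g2 \<tau> (y + b) - g2 \<tau> (y - b)) / 2) (at b)" for b
  proof -
    have g: "((\<lambda>b. gauss \<tau> (y + b)) has_real_derivative - ((y + b) / \<tau>) * gauss \<tau> (y + b)) (at b)"
      "((\<lambda>b. gauss \<tau> (y - b)) has_real_derivative ((y - b) / \<tau>) * gauss \<tau> (y - b)) (at b)"
      by (rule DERIV_cong[OF DERIV_chain2[OF DERIV_gauss[OF \<tau>(2)]]], (auto intro!: derivative_eq_intros)[1], simp)+
    have l: "((\<lambda>b. 1 + (y + b) * b / \<tau>) has_real_derivative (y + 2 * b) / \<tau>) (at b)"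
      "((\<lambda>b. 1 - (y - b) * b / \<tau>) has_real_derivative - (y - 2 * b) / \<tau>) (at b)"
      using \<tau>(2) by (auto intro!: derivative_eq_intros simp: field_simps)
    have eq: "((- ((y + b) / \<tau>) * P) * (1 + (y + b) * b / \<tau>) + (y + 2 * b) / \<tau> * P -
        (((y - b) / \<tau> * R) * (1 - (y - b) * b / \<tau>) + - (y - 2 * b) / \<tau> * R)) / 2 =
        - b * (((y + b)\<^sup>2 / \<tau>\<^sup>2 - 1 / \<tau>) * P - ((y - b)\<^sup>2 / \<tau>\<^sup>2 - 1 / \<tau>) * R) / 2" for P R
      using \<tau>(2) by (simp add: field_simps power2_eq_square)
    show ?thesis
      using DERIV_cdivide[OF DERIV_diff[OF DERIV_mult[OF g(1) l(1)] DERIV_mult[OF g(2) l(2)]], of 2]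
      unfolding eq g2_def k_def .
  qed
  obtain b where b: "0 < b" "b < t" "k \<tau> t - k \<tau> 0 = t * (- b * (g2 \<tau> (y + b) - g2 \<tau> (y - b)) / 2)"
    using MVT2[of 0 t "k \<tau>" "\<lambda>b. - b * (g2 \<tau> (y + b) - g2 \<tau> (y - b)) / 2"] k' t(1) by auto
  obtain \<xi> where \<xi>: "y - b < \<xi>" "\<xi> < y + b"
    "g2 \<tau> (y + b) - g2 \<tau> (y - b) = (2 * b) * ((3 * \<xi> / \<tau>\<^sup>2 - \<xi> ^ 3 / \<tau> ^ 3) * gauss \<tau> \<xi>)"
    using MVT2[of "y - b" "y + b" "g2 \<tau>" "\<lambda>x. (3 * x / \<tau>\<^sup>2 - x ^ 3 / \<tau> ^ 3) * gauss \<tau> x"]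
      DERIV_gauss3[OF \<tau>(2)] b(1) unfolding g2_def by auto
  define D where "D = (3 * \<xi> / \<tau>\<^sup>2 - \<xi> ^ 3 / \<tau> ^ 3) * gauss \<tau> \<xi>"
  have "w 1 - w 0 = - (t * b * b) * D"
    using t(3) b(3) \<xi>(3) by (simp add: \<tau>_def[symmetric] D_def[symmetric] k_def)
  then have "\<bar>w 1 - w 0\<bar> = t * b * b * \<bar>D\<bar>"
    using t b by (simp add: abs_mult)
  also have "\<dots> \<le> 1 * \<bar>D\<bar>"
    using t b by (intro mult_right_mono mult_le_one) auto
  also have "1 * \<bar>D\<bar> \<le> 54 / (\<tau> * (\<tau> + \<xi>\<^sup>2))"
    using gauss_deriv_bounds(3)[OF \<tau>(2), of \<xi>] by (simp add: D_def)
  also have "\<dots> \<le> 54 / (s * ((s + y\<^sup>2) / 3))"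
  proof (rule divide_left_mono)
    have "(y - \<xi>)\<^sup>2 \<le> 1\<^sup>2"
      using \<xi> b t by (subst abs_le_square_iff[symmetric]) auto
    moreover have "0 \<le> (y - 2 * \<xi>)\<^sup>2" by simp
    ultimately have "y\<^sup>2 \<le> 2 * \<xi>\<^sup>2 + 2" by (simp add: power2_eq_square algebra_simps)
    moreover have "\<xi>\<^sup>2 \<ge> 0" by simp
    ultimately have "s + y\<^sup>2 \<le> 3 * \<tau> + 3 * \<xi>\<^sup>2" using s \<tau> by linarith
    then have "(s + y\<^sup>2) / 3 \<le> \<tau> + \<xi>\<^sup>2" by simp
    then show "s * ((s + y\<^sup>2) / 3) \<le> \<tau> * (\<tau> + \<xi>\<^sup>2)"
      using s \<tau> by (intro mult_mono) auto
    have "s * ((s + y\<^sup>2) / 3) > 0" using s by (auto intro!: mult_pos_pos add_pos_nonneg)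
    moreover have "\<tau> * (\<tau> + \<xi>\<^sup>2) > 0" using \<tau> by (auto intro!: mult_pos_pos add_pos_nonneg)
    ultimately show "0 < \<tau> * (\<tau> + \<xi>\<^sup>2) * (s * ((s + y\<^sup>2) / 3))" by (rule mult_pos_pos[rotated])
  qed simp
  also have "\<dots> = 162 / (s * (s + y\<^sup>2))" by (simp add: field_simps)
  finally show ?thesis by (simp add: w_def add.commute)
qed

text \<open>
  The expectation of \<open>f(y + \<epsilon>)\<close> for a fair sign \<open>\<epsilon>\<close>; its \<open>k\<close>-th iterate is the expectation of \<open>f(y + S\<^sub>k)\<close>
  for the simple random walk \<open>S\<^sub>k\<close>.
\<close>

definition coin :: "(real \<Rightarrow> real) \<Rightarrow> real \<Rightarrow> real" where
  "coin f y = (f (y - 1) + f (y + 1)) / 2"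

definition step :: "real \<Rightarrow> real" where
  "step y = (if 0 \<le> y then 1 else 0)"

lemma coin_power:
  "(coin ^^ k) f y = (\<Sum>i\<le>k. real (k choose i) / 2 ^ k * f (y + 2 * real i - real k))"
proof (induction k arbitrary: y)
  case (Suc k)
  let ?t = "\<lambda>i. f (y + 2 * real i - real (Suc k))"
  have a: "(coin ^^ k) f (y - 1) = (\<Sum>i\<le>k. real (k choose i) / 2 ^ k * ?t i)"
    unfolding Suc by (simp add: algebra_simps)
  have b: "(coin ^^ k) f (y + 1) = (\<Sum>i\<le>k. real (k choose i) / 2 ^ k * ?t (Suc i))"
    unfolding Suc by (simp add: algebra_simps)
  have "(\<Sum>i\<le>Suc k. real (Suc k choose i) / 2 ^ Suc k * ?t i) =
      ?t 0 / 2 ^ Suc k + (\<Sum>i\<le>k. real (Suc k choose Suc i) / 2 ^ Suc k * ?t (Suc i))"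
    by (subst sum.atMost_Suc_shift) simp
  also have "(\<Sum>i\<le>k. real (Suc k choose Suc i) / 2 ^ Suc k * ?t (Suc i)) =
      (\<Sum>i\<le>k. real (k choose i) / 2 ^ Suc k * ?t (Suc i)) +
      (\<Sum>i\<le>k. real (k choose Suc i) / 2 ^ Suc k * ?t (Suc i))"
    by (simp add: sum.distrib[symmetric] add_divide_distrib distrib_right)
  also have "?t 0 / 2 ^ Suc k + (\<dots>) = (\<Sum>i\<le>k. real (k choose i) / 2 ^ Suc k * ?t (Suc i)) +
      (\<Sum>i\<le>Suc k. real (k choose i) / 2 ^ Suc k * ?t i)"
    by (simp only: sum.atMost_Suc_shift[of _ k]) simp
  also have "(\<Sum>i\<le>Suc k. real (k choose i) / 2 ^ Suc k * ?t i) =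
      (\<Sum>i\<le>k. real (k choose i) / 2 ^ Suc k * ?t i)"
    by simp
  finally have "(\<Sum>i\<le>Suc k. real (Suc k choose i) / 2 ^ Suc k * ?t i) =
      ((coin ^^ k) f (y - 1) + (coin ^^ k) f (y + 1)) / 2"
  proof -
    have half: "(\<Sum>i\<le>k. real (k choose i) / 2 ^ Suc k * g i) = (\<Sum>i\<le>k. real (k choose i) / 2 ^ k * g i) / 2"
      for g :: "nat \<Rightarrow> real"
      by (simp add: sum_divide_distrib mult.commute[of 2])
    assume "(\<Sum>i\<le>Suc k. real (Suc k choose i) / 2 ^ Suc k * ?t i) =
      (\<Sum>i\<le>k. real (k choose i) / 2 ^ Suc k * ?t (Suc i)) + (\<Sum>i\<le>k. real (k choose i) / 2 ^ Suc k * ?t i)"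
    then show ?thesis unfolding a b half by (simp only: add_divide_distrib add.commute)
  qed
  moreover have "(coin ^^ Suc k) f y = ((coin ^^ k) f (y - 1) + (coin ^^ k) f (y + 1)) / 2"
    by (simp add: coin_def[of "(coin ^^ k) f"])
  ultimately show ?case by simp
qed simp

lemma central_binomial_le: "real (2 * m choose m) / 4 ^ m \<le> 1 / sqrt (2 * real m + 1)"
proof (induction m)
  case (Suc m)
  have "Suc m * (2 * Suc m choose Suc m) = 2 * (2 * m + 1) * (2 * m choose m)"
  proof -
    have "Suc m * (2 * Suc m choose Suc m) = (2 * m + 2) * (2 * m + 1 choose m)"
      using Suc_times_binomial_eq[of "2 * m + 1" m] by simp
    moreover have "(m + 1) * (2 * m + 1 choose m) = (2 * m + 1) * (2 * m choose m)"
      using binomial_absorb_comp[of "2 * m + 1" m] by simp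
    ultimately show ?thesis by (simp add: algebra_simps)
  qed
  then have "real (Suc m) * real (2 * Suc m choose Suc m) = 2 * (2 * real m + 1) * real (2 * m choose m)"
    by (metis (no_types, lifting) of_nat_1 of_nat_add of_nat_mult of_nat_numeral)
  moreover have "B / 4 ^ Suc m = (2 * real m + 1) / (2 * real m + 2) * (A / 4 ^ m)"
    if "real (Suc m) * B = 2 * (2 * real m + 1) * A" for A B :: real
  proof -
    have "B = 2 * (2 * real m + 1) * A / real (Suc m)" using that by (simp add: field_simps del: of_nat_Suc)
    have "2 * c * A / X / (4 * q) = c / (2 * X) * (A / q)" for c X q :: real
      by (simp add: ac_simps)
    from this[of "2 * real m + 1" "real m + 1" "4 ^ m"] \<open>B = _\<close> show ?thesis
      by (simp add: add.commute)
  qed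
  ultimately have "real (2 * Suc m choose Suc m) / 4 ^ Suc m =
      (2 * real m + 1) / (2 * real m + 2) * (real (2 * m choose m) / 4 ^ m)"
    by blast
  also have "\<dots> \<le> (2 * real m + 1) / (2 * real m + 2) * (1 / sqrt (2 * real m + 1))"
    by (intro mult_left_mono Suc) auto
  also have "\<dots> \<le> 1 / sqrt (2 * real (Suc m) + 1)"
  proof -
    define p where "p = sqrt (2 * real m + 1)"
    define r where "r = sqrt (2 * real m + 3)"
    have pr: "p > 0" "r > 0" "p * p = 2 * real m + 1" by (auto simp: p_def r_def)
    have "p * r = sqrt ((2 * real m + 1) * (2 * real m + 3))"
      by (simp add: p_def r_def real_sqrt_mult)
    also have "\<dots> \<le> 2 * real m + 2"
      by (intro real_le_lsqrt) (auto simp: power2_eq_square algebra_simps)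
    finally have "p * r \<le> 2 * real m + 2" .
    then have "p / (2 * real m + 2) \<le> 1 / r" using pr by (simp add: field_simps)
    moreover have "(2 * real m + 1) / (2 * real m + 2) * (1 / p) = p / (2 * real m + 2)"
      unfolding pr(3)[symmetric] using pr(1) by simp
    moreover have "2 * real (Suc m) + 1 = 2 * real m + 3" by simp
    ultimately show ?thesis unfolding p_def r_def by (simp add: add.commute)
  qed
  finally show ?case .
qed simp

lemma binomial_prob_le: "real (k choose i) / 2 ^ k \<le> 1 / sqrt (real k + 1)"
proof -
  have "real (k choose i) / 2 ^ k \<le> real (k choose (k div 2)) / 2 ^ k"
    by (intro divide_right_mono) (auto simp: binomial_maximum)
  also have "\<dots> \<le> 1 / sqrt (real k + 1)"
  proof (cases "even k")
    case True
    then obtain m where "k = 2 * m" by auto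
    then show ?thesis using central_binomial_le[of m] by (simp add: power_mult)
  next
    case False
    then obtain m where k: "k = 2 * m + 1" by (auto elim: oddE)
    have "(2 * Suc m choose Suc m) = 2 * (2 * m + 1 choose m)"
      using binomial_symmetric[of m "2 * m + 1"] by simp
    then have "real (k choose (k div 2)) / 2 ^ k = real (2 * Suc m choose Suc m) / 4 ^ Suc m"
      unfolding k by (simp add: power_mult)
    also have "\<dots> \<le> 1 / sqrt (2 * real (Suc m) + 1)" by (rule central_binomial_le)
    also have "\<dots> \<le> 1 / sqrt (real k + 1)"
      unfolding k by (intro divide_left_mono real_sqrt_le_mono) auto
    finally show ?thesis .
  qed
  finally show ?thesis .
qed

text \<open>
  \<open>1/(s + t\<^sup>2)\<close> is the derivative of \<open>arctan (t/s\<^sup>1\<^sup>/\<^sup>2)/s\<^sup>1\<^sup>/\<^sup>2\<close> and varies by at most a constant factor on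
  intervals of length 2, so its sums over lattices of spacing 2 telescope.
\<close>

lemma arctan_increment:
  assumes "s \<ge> 1"
  shows "1 / (s + t\<^sup>2) \<le> 3 / 2 * (arctan ((t + 1) / sqrt s) / sqrt s - arctan ((t - 1) / sqrt s) / sqrt s)"
proof -
  define r where "r = sqrt s"
  have r: "r > 0" "s = r * r" using assms by (auto simp: r_def)
  have d: "((\<lambda>t. arctan (t / r) / r) has_real_derivative 1 / (s + t\<^sup>2)) (at t)" for t
  proof -
    have "((\<lambda>t. arctan (t / r) / r) has_real_derivative (inverse (1 + (t / r)\<^sup>2) * (1 / r)) / r) (at t)"
      using r by (auto intro!: derivative_eq_intros)
    also have "inverse (1 + (t / r)\<^sup>2) * (1 / r) / r = 1 / (s + t\<^sup>2)"
      using r by (simp add: field_simps power2_eq_square add_nonneg_eq_0_iff)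
    finally show ?thesis .
  qed
  obtain \<xi> where \<xi>: "t - 1 < \<xi>" "\<xi> < t + 1"
    "arctan ((t + 1) / r) / r - arctan ((t - 1) / r) / r = (t + 1 - (t - 1)) * (1 / (s + \<xi>\<^sup>2))"
    using MVT2[of "t - 1" "t + 1" "\<lambda>t. arctan (t / r) / r" "\<lambda>t. 1 / (s + t\<^sup>2)"] d by auto
  have "(t - \<xi>)\<^sup>2 \<le> 1\<^sup>2" using \<xi> by (subst abs_le_square_iff[symmetric]) auto
  moreover have "0 \<le> (\<xi> - 2 * t)\<^sup>2" by simp
  ultimately have "\<xi>\<^sup>2 \<le> 2 * t\<^sup>2 + 2" by (simp add: power2_eq_square algebra_simps)
  moreover have "t\<^sup>2 \<ge> 0" by simp
  ultimately have "s + \<xi>\<^sup>2 \<le> 3 * s + 3 * t\<^sup>2" using assms by linarith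
  moreover have "s + \<xi>\<^sup>2 > 0" "s + t\<^sup>2 > 0" using assms by (auto intro: add_pos_nonneg)
  ultimately have "1 / (s + t\<^sup>2) \<le> 3 * (1 / (s + \<xi>\<^sup>2))" by (simp add: field_simps)
  then show ?thesis unfolding r_def[symmetric] \<xi>(3) by simp
qed

text \<open>
  The walk \<open>S\<^sub>k\<close> charges each point with probability at most \<open>(k+1)\<^sup>-\<^sup>1\<^sup>/\<^sup>2\<close>, and a function decaying like
  \<open>c/(s + y\<^sup>2)\<close> has a sum of order \<open>c s\<^sup>-\<^sup>1\<^sup>/\<^sup>2\<close> over the lattice.  It is this gain over the supremum of \<open>e\<close>
  that makes the error terms in the telescoping sum below summable.
\<close>

lemma coin_power_localized:
  assumes s: "s \<ge> 1" and e: "\<And>y. \<bar>e y\<bar> \<le> c / (s + y\<^sup>2)" and c: "c \<ge> 0"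
  shows "\<bar>(coin ^^ k) e y\<bar> \<le> 5 * c / (sqrt (real k + 1) * sqrt s)"
proof -
  \<comment> \<open>consecutive points \<open>y - k + 2 i\<close> of the walk have distance 2, so their unit neighbourhoods abut\<close>
  define \<theta> where "\<theta> i = arctan ((y - real k - 1 + 2 * real i) / sqrt s) / sqrt s" for i
  have "\<bar>(coin ^^ k) e y\<bar> \<le> (\<Sum>i\<le>k. 1 / sqrt (real k + 1) * (c * (3 / 2 * (\<theta> (Suc i) - \<theta> i))))"
    unfolding coin_power
  proof (rule order_trans[OF sum_abs sum_mono])
    fix i assume "i \<in> {..k}"
    let ?t = "y + 2 * real i - real k"
    have "\<bar>e ?t\<bar> \<le> c * (1 / (s + ?t\<^sup>2))" using e[of ?t] by simp
    also have "\<dots> \<le> c * (3 / 2 * (\<theta> (Suc i) - \<theta> i))"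
      using arctan_increment[OF s, of ?t] c
      by (intro mult_left_mono) (auto simp: \<theta>_def algebra_simps)
    finally have "\<bar>e ?t\<bar> \<le> c * (3 / 2 * (\<theta> (Suc i) - \<theta> i))" .
    then show "\<bar>real (k choose i) / 2 ^ k * e ?t\<bar> \<le>
        1 / sqrt (real k + 1) * (c * (3 / 2 * (\<theta> (Suc i) - \<theta> i)))"
      unfolding abs_mult using binomial_prob_le[of k i] by (intro mult_mono) auto
  qed
  also have "\<dots> = 1 / sqrt (real k + 1) * (c * (3 / 2 * (\<theta> (Suc k) - \<theta> 0)))"
    using sum_lessThan_telescope[of \<theta> "Suc k"]
    by (simp only: sum_distrib_left[symmetric] lessThan_Suc_atMost)
  also have "\<dots> \<le> 1 / sqrt (real k + 1) * (c * (5 / sqrt s))"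
  proof (intro mult_left_mono)
    have "\<theta> (Suc k) \<le> (pi / 2) / sqrt s" "- (pi / 2) / sqrt s \<le> \<theta> 0"
      unfolding \<theta>_def using s arctan_ubound arctan_lbound
      by (intro divide_right_mono; auto intro: less_imp_le)+
    then have "3 / 2 * (\<theta> (Suc k) - \<theta> 0) \<le> 3 / 2 * (pi / sqrt s)"
      by (simp add: field_simps)
    also have "\<dots> \<le> 5 / sqrt s" using pi_less_4 pi_approx s by (simp add: field_simps)
    finally show "3 / 2 * (\<theta> (Suc k) - \<theta> 0) \<le> 5 / sqrt s" .
  qed (use c in auto)
  finally show ?thesis by (simp add: mult.commute)
qed

lemma sum_inverse_three_halves:
  "(\<Sum>j<N. 1 / (real (Suc j) * sqrt (real (Suc j)))) \<le> 3 - 2 / sqrt (real N)"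
proof (induction N)
  case (Suc N)
  show ?case
  proof (cases "N = 0")
    case False
    define x where "x = sqrt (real N)"
    define z where "z = sqrt (real (Suc N))"
    have xz: "x > 0" "x \<le> z" "z * z = x * x + 1" "real (Suc N) = z * z" using False by (auto simp: x_def z_def)
    have z: "z > 0" using xz by simp
    have "x * (z + x) \<le> z * (2 * z)" using xz by (intro mult_mono) auto
    then have le: "1 / (z * (z * (2 * z))) \<le> 1 / (z * (x * (z + x)))"
      using xz z by (intro divide_left_mono mult_left_mono) auto
    have "(z - x) * (z + x) = 1" using xz(3) by (simp add: algebra_simps)
    then have "z - x = 1 / (z + x)" using xz(1) z by (simp add: field_simps)
    moreover have "1 / x - 1 / z = (z - x) * (1 / (z * x))" using xz(1) z by (simp add: field_simps)
    ultimately have "1 / x - 1 / z = 1 / (z * (x * (z + x)))" by (simp add: ac_simps)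
    then have "1 / (z * (z * (2 * z))) \<le> 1 / x - 1 / z" using le by simp
    then have "1 / (z * z * z) \<le> 2 / x - 2 / z"
      using z by (simp add: field_simps)
    then show ?thesis using Suc unfolding sum.lessThan_Suc x_def[symmetric] xz(4) z_def[symmetric]
      using z by simp
  qed simp
qed simp

text \<open>
  With \<open>a = j + 1\<close> and \<open>b = K - j\<close> one has \<open>a + b = K + 1\<close>, hence \<open>(K+1)\<^sup>1\<^sup>/\<^sup>2 \<le> a\<^sup>1\<^sup>/\<^sup>2 + b\<^sup>1\<^sup>/\<^sup>2\<close>, and each
  term is at most \<open>(K+1)\<^sup>-\<^sup>1\<^sup>/\<^sup>2\<close> times a combination of \<open>a\<^sup>-\<^sup>3\<^sup>/\<^sup>2\<close> and \<open>b\<^sup>-\<^sup>3\<^sup>/\<^sup>2\<close>, whose sums converge.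
\<close>

lemma sum_convolution_three_halves:
  "(\<Sum>j<K. 1 / (real (Suc j) * sqrt (real (Suc j)) * sqrt (real (K - j)))) \<le> 9 / sqrt (real (Suc K))"
proof -
  define T where "T a = 1 / (real a * sqrt (real a))" for a :: nat
  have T0: "T a \<ge> 0" for a by (simp add: T_def)
  have T3: "(\<Sum>j<K. T (Suc j)) \<le> 3"
    using sum_inverse_three_halves[of K] unfolding T_def
    by (rule order_trans) simp
  have rev: "(\<Sum>j<K. T (K - j)) = (\<Sum>j<K. T (Suc j))"
    by (subst sum.nat_diff_reindex[symmetric]) (auto intro!: sum.cong simp: Suc_diff_Suc)
  have "(\<Sum>j<K. 1 / (real (Suc j) * sqrt (real (Suc j)) * sqrt (real (K - j)))) \<le>
      (\<Sum>j<K. (2 * T (Suc j) + T (K - j)) / sqrt (real (Suc K)))"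
  proof (rule sum_mono)
    fix j assume "j \<in> {..<K}"
    then have j: "j < K" by simp
    define p where "p = sqrt (real (Suc j))"
    define q where "q = sqrt (real (K - j))"
    define r where "r = sqrt (real (Suc K))"
    have pos: "p > 0" "q > 0" "r > 0" using j by (auto simp: p_def q_def r_def)
    have "r \<le> p + q"
    proof -
      have "r = sqrt (real (Suc j) + real (K - j))" using j by (simp add: r_def)
      also have "\<dots> \<le> p + q" unfolding p_def q_def by (rule sqrt_add_le_add_sqrt) auto
      finally show ?thesis .
    qed
    have Tp: "T (Suc j) = 1 / (p * p * p)" "T (K - j) = 1 / (q * q * q)"
      by (simp_all add: T_def p_def q_def)
    \<comment> \<open>compare both sides with the smaller of \<open>p\<close> and \<open>q\<close>\<close>
    have mix: "1 / (p * p * q) \<le> 1 / (p * p * p) + 1 / (q * q * q)"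
    proof (cases "p \<le> q")
      case True
      then have "1 / (p * p * q) \<le> 1 / (p * p * p)"
        using pos by (intro divide_left_mono mult_left_mono) auto
      then show ?thesis using pos by (simp add: add_increasing2)
    next
      case False
      then have "1 / (p * p * q) \<le> 1 / (q * q * q)"
        using pos by (intro divide_left_mono mult_right_mono mult_mono) auto
      then show ?thesis using pos by (simp add: add_increasing)
    qed
    have "r / (p * p * p * q) \<le> (p + q) / (p * p * p * q)"
      using \<open>r \<le> p + q\<close> pos by (intro divide_right_mono) auto
    also have "\<dots> = 1 / (p * p * q) + 1 / (p * p * p)" using pos by (simp add: field_simps)
    also have "\<dots> \<le> 2 * T (Suc j) + T (K - j)" using mix by (simp add: Tp)
    finally have "1 / (p * p * p * q) \<le> (2 * T (Suc j) + T (K - j)) / r"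
      using pos by (simp add: pos_le_divide_eq mult.commute)
    then show "1 / (real (Suc j) * sqrt (real (Suc j)) * sqrt (real (K - j))) \<le>
        (2 * T (Suc j) + T (K - j)) / sqrt (real (Suc K))"
      by (simp add: p_def[symmetric] q_def[symmetric] r_def[symmetric] del: of_nat_Suc)
        (simp add: p_def)
  qed
  also have "\<dots> = (2 * (\<Sum>j<K. T (Suc j)) + (\<Sum>j<K. T (K - j))) / sqrt (real (Suc K))"
    by (simp only: sum_divide_distrib[symmetric] sum.distrib sum_distrib_left)
  also have "\<dots> \<le> 9 / sqrt (real (Suc K))"
    unfolding rev using T3 by (intro divide_right_mono) auto
  finally show ?thesis .
qed

text \<open>
  Chebyshev's inequality for a standard normal variable.
\<close>

lemma Phi_tail: "\<bar>step y - Phi y\<bar> \<le> 2 / (1 + y\<^sup>2)"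
proof -
  interpret real_distribution std_normal_distribution by (rule real_dist_normal_dist)
  have e0: "expectation (\<lambda>x. x) = 0"
    using integral_std_normal_distribution_moment_odd[of 1] by simp
  have e2: "expectation power2 = 1"
    using std_normal_distribution_even_moments(1)[of 1] by simp
  have int: "integrable std_normal_distribution (\<lambda>x. x\<^sup>2)"
    by (rule integrable_std_normal_distribution_moment)
  show ?thesis
  proof (cases "\<bar>y\<bar> \<le> 1")
    case True
    then have "y\<^sup>2 \<le> 1" by (simp add: abs_square_le_1)
    then have "1 \<le> 2 / (1 + y\<^sup>2)" by (simp add: add_pos_nonneg)
    moreover have "\<bar>step y - Phi y\<bar> \<le> 1"
      using Phi_nonneg[of y] Phi_le_1[of y] by (simp add: step_def)
    ultimately show ?thesis by simp
  next
    case False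
    have y2: "y\<^sup>2 \<ge> 1" using False by (metis abs_le_square_iff abs_one linear one_power2)
    have cheb: "prob {x. \<bar>y\<bar> \<le> \<bar>x\<bar>} \<le> 1 / y\<^sup>2"
      using Chebyshev_inequality[of "\<lambda>x. x" "\<bar>y\<bar>"] int False by (simp add: e0 e2)
    have "\<bar>step y - Phi y\<bar> \<le> prob {x. \<bar>y\<bar> \<le> \<bar>x\<bar>}"
    proof (cases "0 \<le> y")
      case True
      have "1 - prob {..y} = prob (UNIV - {..y})"
        using prob_compl[of "{..y}"] by simp
      also have "\<dots> \<le> prob {x. \<bar>y\<bar> \<le> \<bar>x\<bar>}"
        by (intro finite_measure_mono) (use True in auto)
      finally have "1 - Phi y \<le> prob {x. \<bar>y\<bar> \<le> \<bar>x\<bar>}" by (simp add: Phi_def cdf_def)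
      then show ?thesis using True Phi_le_1[of y] by (simp add: step_def)
    next
      case neg: False
      have "Phi y \<le> prob {x. \<bar>y\<bar> \<le> \<bar>x\<bar>}"
        unfolding Phi_def cdf_def by (intro finite_measure_mono) (use neg in auto)
      then show ?thesis using neg Phi_nonneg[of y] by (simp add: step_def)
    qed
    also have "\<dots> \<le> 1 / y\<^sup>2" by (rule cheb)
    also have "1 / y\<^sup>2 = 2 / (2 * y\<^sup>2)" by simp
    also have "\<dots> \<le> 2 / (1 + y\<^sup>2)"
      using y2 by (intro divide_left_mono) (auto intro!: mult_pos_pos add_pos_nonneg simp: zero_less_power2)
    finally show ?thesis .
  qed
qed

lemma coin_sum: "coin (\<lambda>y. \<Sum>j\<in>A. f j y) y = (\<Sum>j\<in>A. coin (f j) y)"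
  by (simp add: coin_def sum.distrib sum_divide_distrib[symmetric])

text \<open>
  Lindeberg's replacement of the coins by normal variables, one at a time, in operator form.
\<close>

lemma coin_power_telescope:
  fixes \<psi> :: "nat \<Rightarrow> real \<Rightarrow> real"
  shows "(coin ^^ K) h y - \<psi> K y = (coin ^^ K) (\<lambda>y. h y - \<psi> 0 y) y +
    (\<Sum>j<K. (coin ^^ (K - Suc j)) (\<lambda>y. coin (\<psi> j) y - \<psi> (Suc j) y) y)"
proof (induction K arbitrary: y)
  case (Suc K)
  let ?e = "\<lambda>j y. coin (\<psi> j) y - \<psi> (Suc j) y"
  have "(coin ^^ Suc K) h y - \<psi> (Suc K) y =
      coin (\<lambda>y. (coin ^^ K) h y - \<psi> K y) y + ?e K y"
    by (simp add: coin_def diff_divide_distrib add_divide_distrib)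
  also have "coin (\<lambda>y. (coin ^^ K) h y - \<psi> K y) y =
      coin (\<lambda>y. (coin ^^ K) (\<lambda>y. h y - \<psi> 0 y) y + (\<Sum>j<K. (coin ^^ (K - Suc j)) (?e j) y)) y"
    by (simp only: Suc)
  also have "\<dots> = (coin ^^ Suc K) (\<lambda>y. h y - \<psi> 0 y) y + (\<Sum>j<K. coin ((coin ^^ (K - Suc j)) (?e j)) y)"
    unfolding coin_sum[symmetric] by (simp add: coin_def add_divide_distrib)
  also have "(\<Sum>j<K. coin ((coin ^^ (K - Suc j)) (?e j)) y) = (\<Sum>j<K. (coin ^^ (Suc K - Suc j)) (?e j) y)"
  proof (intro sum.cong refl)
    fix j assume "j \<in> {..<K}"
    then have "Suc K - Suc j = Suc (K - Suc j)" by auto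
    then show "coin ((coin ^^ (K - Suc j)) (?e j)) y = (coin ^^ (Suc K - Suc j)) (?e j) y"
      by (simp only: funpow.simps comp_apply)
  qed
  finally show ?case by simp
qed simp

lemma Phi_variance_change:
  assumes "0 < p" "p \<le> q"
  shows "\<bar>Phi (y / sqrt p) - Phi (y / sqrt q)\<bar> \<le> (q - p) / p"
proof (cases "p = q")
  case False
  have d: "((\<lambda>t. Phi (y / sqrt t)) has_real_derivative gauss t y * (0 - y * 1 / (2 * t))) (at t)" if "t > 0" for t
    using that by (intro DERIV_Phi_curve) (auto intro!: derivative_eq_intros)
  obtain t where t: "p < t" "t < q" "Phi (y / sqrt q) - Phi (y / sqrt p) = (q - p) * (gauss t y * (0 - y * 1 / (2 * t)))"
    using MVT2[of p q "\<lambda>t. Phi (y / sqrt t)" "\<lambda>t. gauss t y * (0 - y * 1 / (2 * t))"] d assms False by force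
  have t0: "t > 0" using t assms by simp
  have "\<bar>gauss t y * (0 - y * 1 / (2 * t))\<bar> = \<bar>y\<bar> * gauss t y / (2 * t)"
    using t0 gauss_pos[OF t0, of y] by (simp add: abs_mult)
  also have "\<dots> \<le> 2 / (2 * t)"
    using gauss_deriv_bounds(1)[OF t0, of y] t0 by (intro divide_right_mono) auto
  also have "\<dots> \<le> 1 / p" using t assms by (simp add: frac_le)
  finally have "(q - p) * \<bar>gauss t y * (0 - y * 1 / (2 * t))\<bar> \<le> (q - p) * (1 / p)"
    using assms by (intro mult_left_mono) auto
  then have "\<bar>Phi (y / sqrt q) - Phi (y / sqrt p)\<bar> \<le> (q - p) / p"
    unfolding t(3) abs_mult using assms by simp
  then show ?thesis by (simp add: abs_minus_commute)
qed (use assms in auto)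

text \<open>
  The Berry-Esseen bound for the simple random walk.  The comparison functions
  \<open>\<psi>\<^sub>j(y) = \<Phi>(y/(j+1)\<^sup>1\<^sup>/\<^sup>2)\<close> start with variance 1 instead of 0: the jump of the step function
  is thereby replaced at once, at the cost of a localized error, and every later step
  is smooth.
\<close>

lemma coin_power_normal:
  assumes K: "K \<ge> 1"
  shows "\<bar>(coin ^^ K) step y - Phi (y / sqrt (real K))\<bar> \<le> 7500 / sqrt (real K)"
proof -
  define \<psi> where "\<psi> j y = Phi (y / sqrt (real j + 1))" for j y
  let ?e = "\<lambda>j y. coin (\<psi> j) y - \<psi> (Suc j) y"
  have sum: "(coin ^^ K) step y - \<psi> K y = (coin ^^ K) (\<lambda>y. step y - \<psi> 0 y) y +
      (\<Sum>j<K. (coin ^^ (K - Suc j)) (?e j) y)"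
    by (rule coin_power_telescope)
  have "\<bar>step z - \<psi> 0 z\<bar> \<le> 2 / (1 + z\<^sup>2)" for z using Phi_tail[of z] by (simp add: \<psi>_def)
  then have start: "\<bar>(coin ^^ K) (\<lambda>y. step y - \<psi> 0 y) y\<bar> \<le> 10 / sqrt (real K + 1)"
    using coin_power_localized[of 1 "\<lambda>y. step y - \<psi> 0 y" 2 K y] by simp
  have "\<bar>\<Sum>j<K. (coin ^^ (K - Suc j)) (?e j) y\<bar> \<le>
      (\<Sum>j<K. 810 * (1 / (real (Suc j) * sqrt (real (Suc j)) * sqrt (real (K - j)))))"
  proof (rule order_trans[OF sum_abs sum_mono])
    fix j assume "j \<in> {..<K}"
    then have j: "real (K - Suc j) + 1 = real (K - j)" by simp
    have "\<bar>?e j z\<bar> \<le> (162 / real (Suc j)) / (real (Suc j) + z\<^sup>2)" for z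
      using heat_step[of "real (Suc j)" z] by (simp add: \<psi>_def coin_def add.commute)
    from coin_power_localized[OF _ this, of "K - Suc j" y]
    show "\<bar>(coin ^^ (K - Suc j)) (?e j) y\<bar> \<le>
        810 * (1 / (real (Suc j) * sqrt (real (Suc j)) * sqrt (real (K - j))))"
      unfolding j by (simp add: ac_simps)
  qed
  also have "\<dots> \<le> 810 * (9 / sqrt (real (Suc K)))"
    unfolding sum_distrib_left[symmetric] by (intro mult_left_mono sum_convolution_three_halves) auto
  finally have "\<bar>(coin ^^ K) step y - \<psi> K y\<bar> \<le> 7300 / sqrt (real K + 1)"
    unfolding sum using start by (simp add: add.commute)
  also have "\<dots> \<le> 7300 / sqrt (real K)" using K by (intro divide_left_mono) auto
  finally have 1: "\<bar>(coin ^^ K) step y - \<psi> K y\<bar> \<le> 7300 / sqrt (real K)" .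
  have "\<bar>Phi (y / sqrt (real K)) - \<psi> K y\<bar> \<le> 1 / real K"
    using Phi_variance_change[of "real K" "real K + 1" y] K by (simp add: \<psi>_def)
  also have "\<dots> \<le> 1 / sqrt (real K)"
  proof -
    have "sqrt (real K) \<le> real K" using K by (intro real_le_lsqrt) (auto simp: power2_eq_square)
    then show ?thesis using K by (intro divide_left_mono) auto
  qed
  finally have 2: "\<bar>Phi (y / sqrt (real K)) - \<psi> K y\<bar> \<le> 1 / sqrt (real K)" .
  have "7300 / sqrt (real K) + 1 / sqrt (real K) \<le> 7500 / sqrt (real K)"
    by (simp add: add_divide_distrib[symmetric] divide_right_mono)
  then show ?thesis using 1 2 by linarith
qed

text \<open>
  The version for a random number of coins: the variance of the comparison law is a fixed \<open>s\<close>, and a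
  deviation of \<open>K\<close> from \<open>s\<close> is paid for in proportion.  If \<open>K < s/2\<close> the right-hand side exceeds 1.
\<close>

lemma coin_power_normal_variance:
  assumes s: "s > 0"
  shows "\<bar>(coin ^^ K) step y - Phi (y / sqrt s)\<bar> \<le> 15000 / sqrt s + 2 * \<bar>real K - s\<bar> / s"
proof (cases "real K \<ge> s / 2")
  case True
  then have K: "K \<ge> 1" using s by (cases K) auto
  have "sqrt s / 2 \<le> sqrt (real K)"
  proof (rule real_le_rsqrt)
    have "(sqrt s / 2)\<^sup>2 = s / 4" using s by (simp add: power_divide)
    then show "(sqrt s / 2)\<^sup>2 \<le> real K" using True s by simp
  qed
  then have "7500 / sqrt (real K) \<le> 7500 / (sqrt s / 2)"
    using s K by (intro divide_left_mono) auto
  then have 1: "\<bar>(coin ^^ K) step y - Phi (y / sqrt (real K))\<bar> \<le> 15000 / sqrt s"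
    using coin_power_normal[OF K, of y] by simp
  have "\<bar>Phi (y / sqrt (real K)) - Phi (y / sqrt s)\<bar> \<le> \<bar>real K - s\<bar> / min (real K) s"
  proof (cases "real K \<le> s")
    case True
    then show ?thesis using Phi_variance_change[of "real K" s y] K by (simp add: abs_minus_commute)
  next
    case False
    then show ?thesis using Phi_variance_change[of s "real K" y] s by (simp add: abs_minus_commute)
  qed
  also have "\<dots> \<le> \<bar>real K - s\<bar> / (s / 2)"
    using True s K by (intro divide_left_mono) auto
  also have "\<dots> = 2 * \<bar>real K - s\<bar> / s" by simp
  finally show ?thesis using 1 by linarith
next
  case False
  have "0 \<le> (coin ^^ K) step y" "(coin ^^ K) step y \<le> 1"
  proof -
    show "0 \<le> (coin ^^ K) step y" by (simp add: coin_power step_def sum_nonneg)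
    have "(coin ^^ K) step y \<le> (\<Sum>i\<le>K. real (K choose i) / 2 ^ K * 1)"
      unfolding coin_power by (intro sum_mono mult_left_mono) (auto simp: step_def)
    also have "\<dots> = real (\<Sum>i\<le>K. K choose i) / 2 ^ K"
      by (simp add: sum_divide_distrib)
    also have "\<dots> = 1" unfolding choose_row_sum by simp
    finally show "(coin ^^ K) step y \<le> 1" .
  qed
  then have "\<bar>(coin ^^ K) step y - Phi (y / sqrt s)\<bar> \<le> 1"
    using Phi_nonneg[of "y / sqrt s"] Phi_le_1[of "y / sqrt s"] by linarith
  also have "\<dots> \<le> 2 * \<bar>real K - s\<bar> / s" using False s by (simp add: field_simps)
  also have "\<dots> \<le> 15000 / sqrt s + 2 * \<bar>real K - s\<bar> / s" using s by simp
  finally show ?thesis .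
qed

lemma coin_power_identity: "(coin ^^ k) (\<lambda>x. x) y = y"
  by (induction k arbitrary: y) (simp_all add: coin_def[of "(coin ^^ _) _"])

lemma coin_power_square: "(coin ^^ k) (\<lambda>x. (x - m)\<^sup>2) y = (y - m)\<^sup>2 + real k"
proof (induction k arbitrary: y)
  case (Suc k)
  show ?case
    by (simp only: funpow.simps comp_apply coin_def[of "(coin ^^ k) _"] Suc)
      (simp add: power2_eq_square field_simps)
qed simp

lemma coin_power_reflect: "(coin ^^ k) (\<lambda>x. f (z - x)) y = (coin ^^ k) f (z - y)"
proof (induction k arbitrary: y)
  case (Suc k)
  have "z - (y - 1) = z - y + 1" "z - (y + 1) = z - y - 1" by simp_all
  then show ?case
    by (simp only: funpow.simps comp_apply coin_def[of "(coin ^^ k) _"] Suc) (simp only: add.commute)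
qed simp

section \<open>Averages over finite sets\<close>

definition avg :: "'a set \<Rightarrow> ('a \<Rightarrow> real) \<Rightarrow> real" where
  "avg S F = (\<Sum>s\<in>S. F s) / real (card S)"

lemma avg_const: "finite S \<Longrightarrow> S \<noteq> {} \<Longrightarrow> avg S (\<lambda>s. c) = c"
  by (simp add: avg_def)

lemma avg_add: "avg S (\<lambda>s. F s + G s) = avg S F + avg S G"
  and avg_diff: "avg S (\<lambda>s. F s - G s) = avg S F - avg S G"
  and avg_mult_right: "avg S (\<lambda>s. F s * c) = avg S F * c"
  and avg_mult_left: "avg S (\<lambda>s. c * F s) = c * avg S F"
  and avg_divide: "avg S (\<lambda>s. F s / c) = avg S F / c"
  by (simp_all add: avg_def sum.distrib sum_subtractf add_divide_distrib diff_divide_distrib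
      sum_distrib_left sum_distrib_right sum_divide_distrib mult.commute)

lemma avg_sum: "avg S (\<lambda>s. \<Sum>p\<in>P. F p s) = (\<Sum>p\<in>P. avg S (F p))"
  unfolding avg_def by (subst sum.swap) (simp add: sum_divide_distrib)

lemma avg_swap: "avg S (\<lambda>s. avg T (\<lambda>t. F s t)) = avg T (\<lambda>t. avg S (\<lambda>s. F s t))"
  unfolding avg_def sum_divide_distrib[symmetric] by (subst sum.swap) (simp add: mult.commute)

lemma avg_cong: "(\<And>s. s \<in> S \<Longrightarrow> F s = G s) \<Longrightarrow> avg S F = avg S G"
  by (simp add: avg_def)

lemma avg_mono: "(\<And>s. s \<in> S \<Longrightarrow> F s \<le> G s) \<Longrightarrow> avg S F \<le> avg S G"
  unfolding avg_def by (intro divide_right_mono sum_mono) auto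

lemma avg_abs_le: "\<bar>avg S F\<bar> \<le> avg S (\<lambda>s. \<bar>F s\<bar>)"
  unfolding avg_def by (simp add: divide_right_mono)

lemma avg_bound:
  assumes "finite S" "S \<noteq> {}" "\<And>s. s \<in> S \<Longrightarrow> \<bar>F s\<bar> \<le> c"
  shows "\<bar>avg S F\<bar> \<le> c"
  using order_trans[OF avg_abs_le avg_mono[of S "\<lambda>s. \<bar>F s\<bar>" "\<lambda>_. c"]] assms
  by (simp add: avg_const)

text \<open>
  The tower property.  The sets \<open>C s\<close> are the blocks of a partition, on each of which \<open>h\<close> is constant, and
  \<open>avg (C s) F\<close> is the conditional expectation of \<open>F\<close> given the block of \<open>s\<close>.
\<close>

lemma sum_conditional:
  fixes F h :: "'a \<Rightarrow> real"
  assumes fin: "finite S"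
    and C: "\<And>s. s \<in> S \<Longrightarrow> s \<in> C s \<and> C s \<subseteq> S"
    and const: "\<And>s t. s \<in> S \<Longrightarrow> t \<in> C s \<Longrightarrow> C t = C s \<and> h t = h s"
  shows "(\<Sum>s\<in>S. h s * F s) = (\<Sum>s\<in>S. h s * avg (C s) F)"
proof -
  have sym: "t \<in> C s \<longleftrightarrow> s \<in> C t" if "s \<in> S" "t \<in> S" for s t
    using C const that by blast
  have "(\<Sum>s\<in>S. h s * avg (C s) F) = (\<Sum>s\<in>S. \<Sum>t\<in>S. if t \<in> C s then h s * F t / card (C s) else 0)"
  proof (rule sum.cong[OF refl])
    fix s assume s: "s \<in> S"
    have "(\<Sum>t\<in>S. if t \<in> C s then h s * F t / card (C s) else 0) = (\<Sum>t\<in>C s. h s * F t / card (C s))"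
      using C[OF s] fin by (subst sum.inter_restrict[symmetric]) (auto intro!: sum.cong)
    then show "h s * avg (C s) F = (\<Sum>t\<in>S. if t \<in> C s then h s * F t / card (C s) else 0)"
      by (simp add: avg_def sum_distrib_left sum_divide_distrib)
  qed
  also have "\<dots> = (\<Sum>t\<in>S. \<Sum>s\<in>S. if t \<in> C s then h s * F t / card (C s) else 0)"
    by (rule sum.swap)
  also have "\<dots> = (\<Sum>t\<in>S. h t * F t)"
  proof (rule sum.cong[OF refl])
    fix t assume t: "t \<in> S"
    have fC: "finite (C t)" "C t \<noteq> {}" using C[OF t] fin by (auto intro: finite_subset)
    have "(\<Sum>s\<in>S. if t \<in> C s then h s * F t / card (C s) else 0) =
        (\<Sum>s\<in>S. if s \<in> C t then h t * F t / card (C t) else 0)"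
    proof (rule sum.cong[OF refl])
      fix s assume s: "s \<in> S"
      show "(if t \<in> C s then h s * F t / card (C s) else 0) = (if s \<in> C t then h t * F t / card (C t) else 0)"
      proof (cases "t \<in> C s")
        case True
        then show ?thesis using sym[OF s t] const[OF s True] by simp
      qed (use sym[OF s t] in simp)
    qed
    also have "\<dots> = (\<Sum>s\<in>C t. h t * F t / card (C t))"
      unfolding sum.inter_restrict[OF fin, symmetric] using C[OF t] by (simp add: Int_absorb1)
    also have "\<dots> = h t * F t" using fC by simp
    finally show "(\<Sum>s\<in>S. if t \<in> C s then h s * F t / card (C s) else 0) = h t * F t" .
  qed
  finally show ?thesis by simp
qed

lemma avg_tower:
  assumes "finite S"
    and "\<And>s. s \<in> S \<Longrightarrow> s \<in> C s \<and> C s \<subseteq> S"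
    and "\<And>s t. s \<in> S \<Longrightarrow> t \<in> C s \<Longrightarrow> C t = C s \<and> h t = h s"
  shows "avg S (\<lambda>s. h s * F s) = avg S (\<lambda>s. h s * avg (C s) F)"
  unfolding avg_def[of S] using sum_conditional[OF assms, of F] by simp

section \<open>Resampling one position of a random permutation\<close>

abbreviation swap :: "'a \<Rightarrow> 'a \<Rightarrow> 'a \<Rightarrow> 'a" where
  "swap \<equiv> Transposition.transpose"

text \<open>
  The properties of a double coset that matter: it is closed under transpositions inside a block of
  positions or inside a block of values, and all its elements have the same contingency table.  Blocks
  are given by labels \<open>row\<close> of positions and \<open>col\<close> of values.
\<close>

locale position_value_blocks =
  fixes n :: nat and row col :: "nat \<Rightarrow> nat" and D :: "(nat \<Rightarrow> nat) set"
  assumes permutes: "s \<in> D \<Longrightarrow> s permutes {1..n}"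
    and nonempty: "D \<noteq> {}"
    and swap_positions: "s \<in> D \<Longrightarrow> q \<in> {1..n} \<Longrightarrow> r \<in> {1..n} \<Longrightarrow> row q = row r \<Longrightarrow>
      s \<circ> swap q r \<in> D"
    and swap_values: "s \<in> D \<Longrightarrow> x \<in> {1..n} \<Longrightarrow> y \<in> {1..n} \<Longrightarrow> col x = col y \<Longrightarrow>
      swap x y \<circ> s \<in> D"
    and same_table: "s \<in> D \<Longrightarrow> t \<in> D \<Longrightarrow>
      card {p \<in> {1..n}. row p = i \<and> col (s p) = j} = card {p \<in> {1..n}. row p = i \<and> col (t p) = j}"
begin

lemma finite_D: "finite D"
  by (rule finite_subset[OF _ finite_permutations[of "{1..n}"]]) (use permutes in auto)

text \<open>
  Averages over \<open>cell s A\<close> are expectations conditioned on the values at the positions in \<open>A\<close>.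
\<close>

definition cell :: "(nat \<Rightarrow> nat) \<Rightarrow> nat set \<Rightarrow> (nat \<Rightarrow> nat) set" where
  "cell s A = {t \<in> D. \<forall>a\<in>A. t a = s a}"

lemma cell_subset: "cell s A \<subseteq> D" and cell_empty: "cell s {} = D"
  by (auto simp: cell_def)

lemma cell_self: "s \<in> D \<Longrightarrow> s \<in> cell s A"
  by (simp add: cell_def)

lemma finite_cell: "finite (cell s A)"
  by (rule finite_subset[OF cell_subset finite_D])

lemma perm_in: "s \<in> D \<Longrightarrow> p \<in> {1..n} \<Longrightarrow> s p \<in> {1..n}"
  using permutes_in_image[OF permutes, of s p] by simp

lemma perm_inj: "s \<in> D \<Longrightarrow> s p = s q \<longleftrightarrow> p = q"
  by (rule inj_eq[OF permutes_inj[OF permutes]])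

lemma perm_inverse: "s \<in> D \<Longrightarrow> s p = y \<longleftrightarrow> p = inv s y"
  using permutes_inverses[OF permutes, of s] by metis

text \<open>
  Exchange the entries at positions \<open>q\<close> and \<open>r\<close>, and then the value that has just left position \<open>q\<close> with \<open>y\<close>.
  Outside \<open>q\<close>, \<open>r\<close> and the position of \<open>y\<close> nothing changes.
\<close>

definition move :: "(nat \<Rightarrow> nat) \<Rightarrow> nat \<Rightarrow> nat \<Rightarrow> nat \<Rightarrow> nat \<Rightarrow> nat" where
  "move s q r y = swap (s q) y \<circ> s \<circ> swap q r"

lemma move_in_D:
  assumes "s \<in> D" "q \<in> {1..n}" "r \<in> {1..n}" "y \<in> {1..n}" "row r = row q" "col y = col (s q)"
  shows "move s q r y \<in> D"
  unfolding move_def comp_assoc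
  using assms perm_in[OF assms(1,2)] by (intro swap_values swap_positions) auto

lemma move_other:
  assumes "s \<in> D" "a \<noteq> q" "a \<noteq> r" "a \<noteq> inv s y"
  shows "move s q r y a = s a"
  using assms perm_inj[of s a q] perm_inverse[of s a y]
  by (simp add: move_def transpose_apply_other)

definition position_choices :: "(nat \<Rightarrow> nat) \<Rightarrow> nat set \<Rightarrow> nat \<Rightarrow> nat set" where
  "position_choices s A q = {r \<in> {1..n}. row r = row q} - A"

definition value_choices :: "(nat \<Rightarrow> nat) \<Rightarrow> nat set \<Rightarrow> nat \<Rightarrow> nat set" where
  "value_choices s A q = {y \<in> {1..n}. col y = col (s q)} - s ` A"

text \<open>
  A permutation \<open>t\<close> that agrees with \<open>s0\<close> on \<open>A\<close> is reached exactly once for each admissible \<open>r\<close> with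
  \<open>col (t r) = col (s0 q)\<close>: such an \<open>r\<close> forces \<open>y = t r\<close>, and then the two transpositions can be undone.
  The number of these \<open>r\<close> is an entry of the contingency table minus a correction depending
  only on the values on \<open>A\<close>, so it does not depend on \<open>t\<close>.
\<close>

lemma sum_move:
  fixes F :: "(nat \<Rightarrow> nat) \<Rightarrow> real"
  assumes s0: "s0 \<in> D" and q: "q \<in> {1..n}" "q \<notin> A"
  shows "(\<Sum>s\<in>cell s0 (insert q A). \<Sum>r\<in>position_choices s0 A q. \<Sum>y\<in>value_choices s0 A q. F (move s q r y)) =
    real (card {r \<in> position_choices s0 A q. col (s0 r) = col (s0 q)}) * (\<Sum>t\<in>cell s0 A. F t)"
proof -
  define x where "x = s0 q"
  define B where "B = cell s0 (insert q A)"
  define L where "L = position_choices s0 A q"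
  define Y where "Y = value_choices s0 A q"
  have finL: "finite L" and finY: "finite Y" by (simp_all add: L_def Y_def position_choices_def value_choices_def)
  have x: "x \<in> {1..n}" unfolding x_def by (rule perm_in[OF s0 q(1)])
  have sB: "s q = x" "s \<in> D" if "s \<in> B" for s using that by (auto simp: B_def cell_def x_def)
  have count: "card {r \<in> L. col (t r) = col x} = card {r \<in> L. col (s0 r) = col x}"
    if t: "t \<in> cell s0 A" for t
  proof -
    have eq: "{r \<in> L. col (u r) = col x} = {p \<in> {1..n}. row p = row q \<and> col (u p) = col x} -
        {p \<in> {1..n} \<inter> A. row p = row q \<and> col (s0 p) = col x}" if "u \<in> cell s0 A" for u
      using that by (auto simp: L_def position_choices_def cell_def)
    have sub: "{p \<in> {1..n} \<inter> A. row p = row q \<and> col (s0 p) = col x} \<subseteq>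
        {p \<in> {1..n}. row p = row q \<and> col (u p) = col x}" if "u \<in> cell s0 A" for u
      using that by (auto simp: cell_def)
    have s0': "s0 \<in> cell s0 A" using s0 by (rule cell_self)
    have "card {p \<in> {1..n}. row p = row q \<and> col (t p) = col x} =
        card {p \<in> {1..n}. row p = row q \<and> col (s0 p) = col x}"
      by (rule same_table[OF _ s0]) (use t in \<open>simp add: cell_def\<close>)
    then show ?thesis
      unfolding eq[OF t] eq[OF s0'] using sub[OF t] sub[OF s0'] by (simp add: card_Diff_subset)
  qed
  define S2 where "S2 = Sigma (cell s0 A) (\<lambda>t. {r \<in> L. col (t r) = col x})"
  define I where "I = (\<lambda>(t :: nat \<Rightarrow> nat, r). (swap x (t r) \<circ> t \<circ> swap q r, r, t r))"
  define J where "J = (\<lambda>(s, r, y). (move s q r y, r))"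
  have J: "I (J (s, r, y)) = (s, r, y)" "J (s, r, y) \<in> S2" if a: "s \<in> B" "r \<in> L" "y \<in> Y" for s r y
  proof -
    have s: "s q = x" "s \<in> D" using sB a by auto
    have r: "r \<in> {1..n}" "row r = row q" "r \<notin> A" using a(2) by (auto simp: L_def position_choices_def)
    have y: "y \<in> {1..n}" "col y = col x" "y \<notin> s0 ` A" using a(3) by (auto simp: Y_def value_choices_def x_def)
    have mr: "move s q r y r = y" using s by (simp add: move_def)
    show "I (J (s, r, y)) = (s, r, y)"
      unfolding I_def J_def prod.case mr unfolding move_def s(1) by (auto simp: fun_eq_iff)
    have "move s q r y \<in> cell s0 A"
      unfolding cell_def
    proof (intro CollectI conjI ballI)
      show "move s q r y \<in> D" using s q r y by (intro move_in_D) auto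
      fix b assume b: "b \<in> A"
      have sb: "s b = s0 b" using a(1) b by (auto simp: B_def cell_def)
      have "b \<noteq> q" "b \<noteq> r" using b q r by auto
      moreover have "s b \<noteq> y" using sb b y by auto
      then have "b \<noteq> inv s y" using perm_inverse[OF s(2)] by auto
      ultimately show "move s q r y b = s0 b" using move_other[OF s(2)] sb by simp
    qed
    then show "J (s, r, y) \<in> S2" using mr y a by (simp add: S2_def J_def)
  qed
  have I: "J (I (t, r)) = (t, r)" "I (t, r) \<in> B \<times> L \<times> Y" if b: "(t, r) \<in> S2" for t r
  proof -
    have tr: "t \<in> cell s0 A" "r \<in> L" "col (t r) = col x" using b by (auto simp: S2_def)
    have t: "t \<in> D" using tr by (auto simp: cell_def)
    have r: "r \<in> {1..n}" "row r = row q" "r \<notin> A" using tr by (auto simp: L_def position_choices_def)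
    have tA: "t a = s0 a" if "a \<in> A" for a using tr that by (auto simp: cell_def)
    define s where "s = swap x (t r) \<circ> t \<circ> swap q r"
    have sq: "s q = x" by (simp add: s_def)
    show "J (I (t, r)) = (t, r)"
      unfolding I_def J_def prod.case s_def[symmetric] move_def sq unfolding s_def by (auto simp: fun_eq_iff)
    have "s \<in> B" unfolding B_def cell_def
    proof (intro CollectI conjI ballI)
      show "s \<in> D" unfolding s_def comp_assoc
        using t r q(1) x tr(3) perm_in[OF t r(1)] by (intro swap_values swap_positions) auto
      fix a assume a: "a \<in> insert q A"
      show "s a = s0 a"
      proof (cases "a = q")
        case False
        then have "a \<in> A" using a by auto
        moreover have "a \<noteq> r" using \<open>a \<in> A\<close> r by auto
        moreover have "t a \<noteq> x" using tA[OF \<open>a \<in> A\<close>] False perm_inj[OF s0] by (simp add: x_def)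
        moreover have "t a \<noteq> t r" using \<open>a \<noteq> r\<close> perm_inj[OF t] by simp
        ultimately show ?thesis using False tA by (simp add: s_def transpose_apply_other)
      qed (simp add: sq x_def)
    qed
    moreover have "t r \<notin> s0 ` A"
    proof
      assume "t r \<in> s0 ` A"
      then obtain a where a: "a \<in> A" "t r = s0 a" by auto
      then have "r = a" using tA[OF a(1)] perm_inj[OF t, of r a] by simp
      then show False using a r by simp
    qed
    then have "t r \<in> Y"
      using perm_in[OF t r(1)] tr(3) by (simp add: Y_def value_choices_def x_def)
    ultimately show "I (t, r) \<in> B \<times> L \<times> Y"
      using tr(2) by (simp add: s_def I_def)
  qed
  have "(\<Sum>s\<in>B. \<Sum>r\<in>L. \<Sum>y\<in>Y. F (move s q r y)) = (\<Sum>(s, r, y)\<in>B \<times> L \<times> Y. F (move s q r y))"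
    by (simp add: sum.cartesian_product)
  also have "\<dots> = (\<Sum>(t, r)\<in>S2. F t)"
  proof (rule sum.reindex_bij_witness[where i = I and j = J])
    fix z assume "z \<in> B \<times> L \<times> Y"
    then show "I (J z) = z" "J z \<in> S2" "(case J z of (t, r) \<Rightarrow> F t) = (case z of (s, r, y) \<Rightarrow> F (move s q r y))"
      using J by (cases z, auto simp: J_def)+
  next
    fix z assume "z \<in> S2"
    then show "J (I z) = z" "I z \<in> B \<times> L \<times> Y" using I by (cases z; auto)+
  qed
  also have "\<dots> = (\<Sum>t\<in>cell s0 A. \<Sum>r | r \<in> L \<and> col (t r) = col x. F t)"
    unfolding S2_def by (subst sum.Sigma[symmetric]) (auto simp: finite_cell finL)
  also have "\<dots> = (\<Sum>t\<in>cell s0 A. real (card {r \<in> L. col (s0 r) = col x}) * F t)"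
    using count by (intro sum.cong refl) simp
  finally show ?thesis
    unfolding B_def L_def Y_def x_def by (simp add: sum_distrib_left)
qed

lemma choices:
  assumes "s0 \<in> D" "q \<in> {1..n}" "q \<notin> A"
  shows "finite (position_choices s0 A q)" "q \<in> position_choices s0 A q"
    and "finite (value_choices s0 A q)" "s0 q \<in> value_choices s0 A q"
  using assms(2,3) perm_in[OF assms(1,2)] perm_inj[OF assms(1)]
  by (auto simp: position_choices_def value_choices_def)

text \<open>
  Resampling: starting from the law conditioned on the values at \<open>A\<close> and at \<open>q\<close>, a move with uniform choices
  of \<open>r\<close> and \<open>y\<close> produces the law conditioned on the values at \<open>A\<close> alone.
\<close>

lemma avg_move:
  assumes s0: "s0 \<in> D" and q: "q \<in> {1..n}" "q \<notin> A"
  shows "avg (cell s0 (insert q A)) (\<lambda>s. avg (position_choices s0 A q) (\<lambda>r.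
           avg (value_choices s0 A q) (\<lambda>y. F (move s q r y)))) = avg (cell s0 A) F"
proof -
  let ?B = "cell s0 (insert q A)" and ?L = "position_choices s0 A q" and ?Y = "value_choices s0 A q"
  \<comment> \<open>positive, because \<open>r = q\<close> is always counted\<close>
  define N where "N = real (card {r \<in> ?L. col (s0 r) = col (s0 q)})"
  note ch = choices[OF s0 q]
  have "{r \<in> ?L. col (s0 r) = col (s0 q)} \<noteq> {}" using ch(2) by auto
  then have N: "N > 0" using ch(1) by (simp add: N_def card_gt_0_iff)
  have "real (card ?B) * (real (card ?L) * real (card ?Y)) = N * real (card (cell s0 A))"
    using sum_move[OF s0 q, of "\<lambda>_. 1"] by (simp add: N_def)
  moreover have "avg ?B (\<lambda>s. avg ?L (\<lambda>r. avg ?Y (\<lambda>y. F (move s q r y)))) =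
      (N * (\<Sum>t\<in>cell s0 A. F t)) / (real (card ?B) * (real (card ?L) * real (card ?Y)))"
    unfolding avg_def sum_divide_distrib[symmetric] N_def sum_move[OF s0 q, symmetric] by (simp add: ac_simps)
  ultimately show ?thesis using N by (simp add: avg_def)
qed

definition move_lipschitz :: "((nat \<Rightarrow> nat) \<Rightarrow> real) \<Rightarrow> real \<Rightarrow> bool" where
  "move_lipschitz F c \<longleftrightarrow> (\<forall>s\<in>D. \<forall>q\<in>{1..n}. \<forall>r\<in>{1..n}. \<forall>y\<in>{1..n}.
     row r = row q \<longrightarrow> col y = col (s q) \<longrightarrow> \<bar>F s - F (move s q r y)\<bar> \<le> c)"

lemma avg_cell_insert_diff:
  assumes s0: "s0 \<in> D" and q: "q \<in> {1..n}" "q \<notin> A"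
  shows "avg (cell s0 (insert q A)) F - avg (cell s0 A) F =
    avg (position_choices s0 A q) (\<lambda>r. avg (value_choices s0 A q) (\<lambda>y.
      avg (cell s0 (insert q A)) (\<lambda>s. F s - F (move s q r y))))"
proof -
  let ?B = "cell s0 (insert q A)" and ?L = "position_choices s0 A q" and ?Y = "value_choices s0 A q"
  have ne: "finite ?L" "?L \<noteq> {}" "finite ?Y" "?Y \<noteq> {}" using choices[OF s0 q] by auto
  have "avg ?B F = avg ?L (\<lambda>r. avg ?Y (\<lambda>y. avg ?B F))" using ne by (simp add: avg_const)
  moreover have "avg (cell s0 A) F = avg ?L (\<lambda>r. avg ?Y (\<lambda>y. avg ?B (\<lambda>s. F (move s q r y))))"
    unfolding avg_move[OF s0 q, symmetric] by (simp add: avg_swap[of ?B])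
  ultimately show ?thesis by (simp only: avg_diff)
qed

lemma cell_insert_outside:
  assumes "s0 \<in> D" "q \<notin> {1..n}"
  shows "cell s0 (insert q A) = cell s0 A"
proof -
  have "t q = q" if "t \<in> D" for t using permutes_not_in[OF permutes[OF that] assms(2)] .
  from this this[OF assms(1)] show ?thesis by (auto simp: cell_def)
qed

text \<open>
  Releasing the positions in \<open>A\<close> one after the other, each by one move.
\<close>

lemma avg_cell_lipschitz:
  assumes s0: "s0 \<in> D" and lip: "move_lipschitz F c" and c: "c \<ge> 0" and fin: "finite A"
  shows "\<bar>avg (cell s0 A) F - avg D F\<bar> \<le> real (card A) * c"
  using fin
proof (induction A rule: finite_induct)
  case (insert q A)
  show ?case
  proof (cases "q \<in> {1..n}")
    case True
    let ?L = "position_choices s0 A q" and ?Y = "value_choices s0 A q"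
    have ne: "finite ?L" "?L \<noteq> {}" "finite ?Y" "?Y \<noteq> {}" using choices[OF s0 True insert(2)] by auto
    have "\<bar>avg (cell s0 (insert q A)) F - avg (cell s0 A) F\<bar> \<le> c"
      unfolding avg_cell_insert_diff[OF s0 True insert(2)]
    proof (intro avg_bound ne finite_cell)
      show "cell s0 (insert q A) \<noteq> {}" using cell_self[OF s0] by blast
      fix r y s assume "r \<in> ?L" "y \<in> ?Y" "s \<in> cell s0 (insert q A)"
      then show "\<bar>F s - F (move s q r y)\<bar> \<le> c"
        using lip True unfolding move_lipschitz_def
        by (auto simp: position_choices_def value_choices_def cell_def)
    qed
    then show ?thesis using insert by (simp add: algebra_simps)
  next
    case False
    then show ?thesis
      using insert c cell_insert_outside[OF s0 False, of A] by (auto simp: algebra_simps) 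
  qed
qed (simp add: cell_empty)

end

section \<open>A Stein identity for sums of window functions\<close>

definition window :: "nat \<Rightarrow> nat set" where
  "window p = {p - 1..p + 2}"

text \<open>
  Sums of bounded functions of windows of four consecutive positions.
\<close>

locale local_functional = position_value_blocks +
  fixes g :: "nat \<Rightarrow> (nat \<Rightarrow> nat) \<Rightarrow> real" and b :: real
  assumes depends_on_window: "(\<And>a. a \<in> window p \<Longrightarrow> s a = t a) \<Longrightarrow> g p s = g p t"
    and bounded: "\<bar>g p s\<bar> \<le> b"
begin

definition total :: "(nat \<Rightarrow> nat) \<Rightarrow> real" where
  "total s = (\<Sum>p\<in>{1..n}. g p s)"

lemma b_nonneg: "b \<ge> 0"
  using bounded[of 0 id] by linarith

text \<open>
  The union of all windows that meet \<open>Z\<close>: changing a permutation on \<open>Z\<close>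
  only affects summands that are determined by the values on \<open>near Z\<close>.
\<close>

definition near :: "nat set \<Rightarrow> nat set" where
  "near Z = (\<Union>z\<in>Z. {z - 3..z + 3})"

lemma card_near:
  assumes "finite Z"
  shows "finite (near Z)" "card (near Z) \<le> 7 * card Z"
proof -
  show "finite (near Z)" using assms by (simp add: near_def)
  have "card (near Z) \<le> (\<Sum>z\<in>Z. card {z - 3..z + 3})"
    unfolding near_def by (rule card_UN_le[OF assms])
  also have "\<dots> \<le> (\<Sum>z\<in>Z. 7)" by (intro sum_mono) auto
  finally show "card (near Z) \<le> 7 * card Z" by simp
qed

lemma window_subset_near: "window p \<inter> Z \<noteq> {} \<Longrightarrow> window p \<subseteq> near Z"
  by (force simp: window_def near_def)

lemma total_change:
  assumes "finite Z" "\<And>a. a \<notin> Z \<Longrightarrow> s a = t a"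
  shows "total s - total t = (\<Sum>p\<in>{p \<in> {1..n}. window p \<inter> Z \<noteq> {}}. g p s - g p t)"
proof -
  have "g p s = g p t" if "window p \<inter> Z = {}" for p
    using that assms(2) by (intro depends_on_window) blast
  then show ?thesis unfolding total_def sum_subtractf[symmetric]
    by (intro sum.mono_neutral_right) auto
qed

lemma total_change_bound:
  assumes "finite Z" "\<And>a. a \<notin> Z \<Longrightarrow> s a = t a"
  shows "\<bar>total s - total t\<bar> \<le> 8 * b * real (card Z)"
proof -
  let ?P = "{p \<in> {1..n}. window p \<inter> Z \<noteq> {}}"
  have "?P \<subseteq> (\<Union>z\<in>Z. {z - 2..z + 1})"
  proof
    fix p assume "p \<in> ?P"
    then obtain z where z: "z \<in> Z" "z \<in> window p" by blast
    then have "p \<in> {z - 2..z + 1}" by (auto simp: window_def)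
    then show "p \<in> (\<Union>z\<in>Z. {z - 2..z + 1})" using z by blast
  qed
  then have "card ?P \<le> card (\<Union>z\<in>Z. {z - 2..z + 1})" using assms(1) by (intro card_mono) auto
  also have "\<dots> \<le> (\<Sum>z\<in>Z. card {z - 2..z + 1})" by (rule card_UN_le[OF assms(1)])
  \<comment> \<open>a position lies in at most four windows\<close>
  also have "\<dots> \<le> (\<Sum>z\<in>Z. 4)" by (intro sum_mono) auto
  finally have P: "real (card ?P) \<le> 4 * real (card Z)" by simp
  have "\<bar>total s - total t\<bar> = \<bar>\<Sum>p\<in>?P. g p s - g p t\<bar>"
    by (rule arg_cong[where f = abs], rule total_change) (use assms in auto)
  also have "\<dots> \<le> (\<Sum>p\<in>?P. 2 * b)"
  proof (rule order_trans[OF sum_abs sum_mono])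
    fix p show "\<bar>g p s - g p t\<bar> \<le> 2 * b" using bounded[of p s] bounded[of p t] by linarith
  qed
  also have "\<dots> = real (card ?P) * (2 * b)" by simp
  also have "\<dots> \<le> 4 * real (card Z) * (2 * b)" using P b_nonneg by (intro mult_right_mono) auto
  finally show ?thesis by (simp add: ac_simps)
qed

lemma card_moved: "card {q, r, z} \<le> 3" for q r z :: nat
  using card_insert_le_m1[of 3 "{r, z}" q] card_insert_le_m1[of 2 "{z}" r] by simp

lemma total_move: "s \<in> D \<Longrightarrow> \<bar>total s - total (move s q r y)\<bar> \<le> 24 * b"
proof -
  assume s: "s \<in> D"
  have "\<bar>total s - total (move s q r y)\<bar> \<le> 8 * b * real (card {q, r, inv s y})"
    by (rule total_change_bound) (use move_other[OF s] in auto)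
  also have "\<dots> \<le> 8 * b * 3"
    using card_moved[of q r "inv s y"] b_nonneg by (intro mult_left_mono) auto
  finally show ?thesis by simp
qed

lemma move_lipschitz_total: "move_lipschitz total (24 * b)"
  unfolding move_lipschitz_def using total_move by blast

text \<open>
  Near independence.  \<open>R s\<close> is a random set of positions that is recognizable from the values on it, like
  a stopping time, and these values determine \<open>h s\<close>.  Conditioning on them moves the mean of
  \<open>F\<close> by at most \<open>k c\<close>.
\<close>

lemma avg_conditional:
  assumes s0: "s0 \<in> D" and lip: "move_lipschitz F c" and c: "c \<ge> 0"
    and R: "\<And>s. s \<in> cell s0 B \<Longrightarrow> finite (R s) \<and> B \<subseteq> R s \<and> card (R s) \<le> k"
    and stop: "\<And>s t. s \<in> cell s0 B \<Longrightarrow> t \<in> cell s (R s) \<Longrightarrow> R t = R s \<and> h t = h s"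
  shows "\<bar>avg (cell s0 B) (\<lambda>s. h s * F s) - avg (cell s0 B) h * avg D F\<bar> \<le>
    avg (cell s0 B) (\<lambda>s. \<bar>h s\<bar>) * (real k * c)"
proof -
  let ?S = "cell s0 B"
  have "avg ?S (\<lambda>s. h s * F s) = avg ?S (\<lambda>s. h s * avg (cell s (R s)) F)"
  proof (rule avg_tower)
    fix s assume s: "s \<in> ?S"
    then show "s \<in> cell s (R s) \<and> cell s (R s) \<subseteq> ?S"
      using R[OF s] by (auto simp: cell_def)
    fix t assume t: "t \<in> cell s (R s)"
    then have "cell t (R s) = cell s (R s)" by (auto simp: cell_def)
    then show "cell t (R t) = cell s (R s) \<and> h t = h s" using stop[OF s t] by simp
  qed (rule finite_cell)
  then have "avg ?S (\<lambda>s. h s * F s) - avg ?S h * avg D F =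
      avg ?S (\<lambda>s. h s * (avg (cell s (R s)) F - avg D F))"
    by (simp add: right_diff_distrib avg_diff avg_mult_right)
  also have "\<bar>\<dots>\<bar> \<le> avg ?S (\<lambda>s. \<bar>h s\<bar> * (real k * c))"
  proof (rule order_trans[OF avg_abs_le avg_mono])
    fix s assume s: "s \<in> ?S"
    then have "\<bar>avg (cell s (R s)) F - avg D F\<bar> \<le> real (card (R s)) * c"
      using avg_cell_lipschitz[OF _ lip c, of s "R s"] R[OF s] by (simp add: cell_def)
    also have "\<dots> \<le> real k * c" using R[OF s] c by (intro mult_right_mono) auto
    finally show "\<bar>h s * (avg (cell s (R s)) F - avg D F)\<bar> \<le> \<bar>h s\<bar> * (real k * c)"
      unfolding abs_mult by (intro mult_left_mono) auto
  qed
  finally show ?thesis by (simp add: avg_mult_right)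
qed

text \<open>
  The increment of the sum under a move is determined by the values near the three positions that are
  involved.  One of them, the position of the value \<open>y\<close>, is random; it is recognizable from these values.
\<close>

lemma total_move_local:
  assumes s: "s \<in> D" and t: "t \<in> cell s (near {q, r, inv s y})"
  shows "inv t y = inv s y"
    and "total t - total (move t q r y) = total s - total (move s q r y)"
proof -
  define Z where "Z = {q, r, inv s y}"
  have tD: "t \<in> D" and ts: "\<And>a. a \<in> near Z \<Longrightarrow> t a = s a"
    using t by (auto simp: cell_def Z_def)
  have Z: "Z \<subseteq> near Z" by (force simp: near_def)
  have "t (inv s y) = s (inv s y)" using ts Z by (auto simp: Z_def)
  also have "\<dots> = y" using perm_inverse[OF s, of "inv s y" y] by simp
  finally show inv: "inv t y = inv s y" using perm_inverse[OF tD] by simp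
  have tq: "t q = s q" using ts Z by (auto simp: Z_def)
  have mv: "move t q r y a = move s q r y a" if "a \<in> near Z" for a
  proof -
    have "swap q r a \<in> near Z" using that Z by (cases "a = q"; cases "a = r") (auto simp: Z_def)
    then show ?thesis using ts by (simp add: move_def tq)
  qed
  have fin: "finite Z" by (simp add: Z_def)
  have "total t - total (move t q r y) = (\<Sum>p\<in>{p \<in> {1..n}. window p \<inter> Z \<noteq> {}}. g p t - g p (move t q r y))"
    by (rule total_change[OF fin]) (use move_other[OF tD] inv in \<open>auto simp: Z_def\<close>)
  also have "\<dots> = (\<Sum>p\<in>{p \<in> {1..n}. window p \<inter> Z \<noteq> {}}. g p s - g p (move s q r y))"
  proof (rule sum.cong[OF refl])
    fix p assume "p \<in> {p \<in> {1..n}. window p \<inter> Z \<noteq> {}}"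
    then have w: "window p \<subseteq> near Z" by (intro window_subset_near) auto
    have "g p t = g p s" using w ts by (intro depends_on_window) auto
    moreover have "g p (move t q r y) = g p (move s q r y)" using w mv by (intro depends_on_window) auto
    ultimately show "g p t - g p (move t q r y) = g p s - g p (move s q r y)" by simp
  qed
  also have "\<dots> = total s - total (move s q r y)"
    by (rule total_change[OF fin, symmetric]) (use move_other[OF s] in \<open>auto simp: Z_def\<close>)
  finally show "total t - total (move t q r y) = total s - total (move s q r y)" .
qed

lemma lipschitz_compose:
  assumes "\<And>u v. \<bar>f' u - f' v\<bar> \<le> H * \<bar>u - v\<bar>" "H \<ge> 0"
  shows "move_lipschitz (\<lambda>s. f' (total s)) (H * (24 * b))"
  unfolding move_lipschitz_def
  using order_trans[OF assms(1) mult_left_mono[OF total_move assms(2)]] by blast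

lemma avg_window:
  "avg D (\<lambda>s. (g p s - avg D (g p)) * F s) =
    avg D (\<lambda>s. (g p s - avg D (g p)) * (avg (cell s (window p)) F - avg D F))"
proof -
  have "avg D (\<lambda>s. (g p s - avg D (g p)) * F s) =
      avg D (\<lambda>s. (g p s - avg D (g p)) * avg (cell s (window p)) F)"
  proof (rule avg_tower)
    fix s assume s: "s \<in> D"
    then show "s \<in> cell s (window p) \<and> cell s (window p) \<subseteq> D" using cell_subset cell_self by blast
    fix t assume t: "t \<in> cell s (window p)"
    then have "cell t (window p) = cell s (window p)" by (auto simp: cell_def)
    moreover have "g p t = g p s" using t by (intro depends_on_window) (simp add: cell_def)
    ultimately show "cell t (window p) = cell s (window p) \<and> g p t - avg D (g p) = g p s - avg D (g p)"
      by simp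
  qed (rule finite_D)
  moreover have "avg D (\<lambda>s. (g p s - avg D (g p)) * avg D F) = 0"
    using finite_D nonempty by (simp add: avg_mult_right avg_diff avg_const)
  ultimately show ?thesis by (simp add: right_diff_distrib avg_diff)
qed

lemma card_window: "finite (window p)" "card (window p) \<le> 4"
  by (auto simp: window_def)

lemma centered_bound: "\<bar>g p s - avg D (g p)\<bar> \<le> 2 * b"
  using bounded[of p s] avg_bound[OF finite_D nonempty, of "g p" b] bounded by fastforce

lemma centered_total:
  "avg D (\<lambda>s. (total s - avg D total) * F s) =
    (\<Sum>p\<in>{1..n}. avg D (\<lambda>s. (g p s - avg D (g p)) * F s))"
  unfolding total_def avg_sum sum_subtractf[symmetric] sum_distrib_right ..

lemma variance_total: "avg D (\<lambda>s. (total s - avg D total)\<^sup>2) = avg D (\<lambda>s. (total s - avg D total) * total s)"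
proof -
  have "avg D (\<lambda>s. (total s - avg D total) * avg D total) = 0"
    using finite_D nonempty by (simp add: avg_mult_right avg_diff avg_const)
  then show ?thesis by (simp add: power2_eq_square right_diff_distrib avg_diff)
qed

context
  fixes f f' :: "real \<Rightarrow> real" and H :: real
  assumes f: "\<And>x. (f has_real_derivative f' x) (at x)"
    and f'_lip: "\<And>u v. \<bar>f' u - f' v\<bar> \<le> H * \<bar>u - v\<bar>" and H: "H \<ge> 0"
begin

text \<open>
  The effect on \<open>E f(M)\<close> of fixing the value at one more position is, to first order, the effect on \<open>E M\<close>
  times \<open>E f'(M)\<close>.  By resampling, the effect is the mean of \<open>f(M) - f(M')\<close> for a move from \<open>M\<close> to \<open>M'\<close>;
  Taylor expansion turns it into \<open>(M - M') f'(M)\<close>, and the increment is nearly independent of \<open>f'(M)\<close>.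
\<close>

lemma response_insert:
  assumes s0: "s0 \<in> D" and q: "q \<in> {1..n}" "q \<notin> A" and A: "finite A" "card A \<le> k"
  shows "\<bar>(avg (cell s0 (insert q A)) (\<lambda>s. f (total s)) - avg (cell s0 A) (\<lambda>s. f (total s))) -
      (avg (cell s0 (insert q A)) total - avg (cell s0 A) total) * avg D (\<lambda>s. f' (total s))\<bar>
    \<le> H * (24 * b)\<^sup>2 * (real k + 23)"
proof -
  let ?B = "cell s0 (insert q A)" and ?L = "position_choices s0 A q" and ?Y = "value_choices s0 A q"
  let ?m = "avg D (\<lambda>s. f' (total s))"
  have ne: "finite ?L" "?L \<noteq> {}" "finite ?Y" "?Y \<noteq> {}" using choices[OF s0 q] by auto
  have neB: "finite ?B" "?B \<noteq> {}" using finite_cell cell_self[OF s0] by blast+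
  define h where "h r y s = total s - total (move s q r y)" for r y s
  define e where "e r y s = f (total s) - f (total (move s q r y)) - h r y s * f' (total s)" for r y s
  have eq: "(avg ?B (\<lambda>s. f (total s)) - avg (cell s0 A) (\<lambda>s. f (total s))) -
      (avg ?B total - avg (cell s0 A) total) * ?m =
    avg ?L (\<lambda>r. avg ?Y (\<lambda>y. avg ?B (e r y) + (avg ?B (\<lambda>s. h r y s * f' (total s)) - avg ?B (h r y) * ?m)))"
    unfolding avg_cell_insert_diff[OF s0 q] avg_mult_right[symmetric] avg_diff[symmetric] avg_add[symmetric]
    by (simp add: e_def h_def left_diff_distrib algebra_simps)
  show ?thesis unfolding eq
  proof (intro avg_bound ne)
    fix r y
    have h: "\<bar>h r y s\<bar> \<le> 24 * b" if "s \<in> D" for s using total_move[OF that] by (simp add: h_def)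
    have "\<bar>avg ?B (e r y)\<bar> \<le> H * (24 * b)\<^sup>2"
    proof (intro avg_bound neB)
      fix s assume "s \<in> ?B"
      then have "s \<in> D" by (simp add: cell_def)
      from taylor_bound[of f f' H, OF f f'_lip H total_move[OF this]]
      show "\<bar>e r y s\<bar> \<le> H * (24 * b)\<^sup>2" unfolding e_def h_def .
    qed
    moreover have "\<bar>avg ?B (\<lambda>s. h r y s * f' (total s)) - avg ?B (h r y) * ?m\<bar> \<le>
        avg ?B (\<lambda>s. \<bar>h r y s\<bar>) * (real (k + 22) * (H * (24 * b)))"
    proof (rule avg_conditional[OF s0 lipschitz_compose, where R = "\<lambda>s. insert q A \<union> near {q, r, inv s y}"])
      fix s assume s: "s \<in> ?B"
      then have sD: "s \<in> D" by (simp add: cell_def)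
      have "card (insert q A \<union> near {q, r, inv s y}) \<le> card (insert q A) + card (near {q, r, inv s y})"
        by (rule card_Un_le)
      \<comment> \<open>a move involves three positions, with at most seven positions near each\<close>
      also have "\<dots> \<le> Suc k + 7 * 3"
        using card_near(2)[of "{q, r, inv s y}"] card_moved[of q r "inv s y"] A q by simp
      finally show "finite (insert q A \<union> near {q, r, inv s y}) \<and> insert q A \<subseteq> insert q A \<union> near {q, r, inv s y} \<and>
          card (insert q A \<union> near {q, r, inv s y}) \<le> k + 22"
        using A card_near(1) by auto
      fix t assume "t \<in> cell s (insert q A \<union> near {q, r, inv s y})"
      then have t: "t \<in> cell s (near {q, r, inv s y})" by (auto simp: cell_def)
      show "insert q A \<union> near {q, r, inv t y} = insert q A \<union> near {q, r, inv s y} \<and> h r y t = h r y s"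
        using total_move_local[OF sD t] by (simp add: h_def)
    qed (use f'_lip H b_nonneg in auto)
    moreover have "avg ?B (\<lambda>s. \<bar>h r y s\<bar>) * (real (k + 22) * (H * (24 * b))) \<le>
        (24 * b) * (real (k + 22) * (H * (24 * b)))"
      using avg_bound[OF neB, of "\<lambda>s. \<bar>h r y s\<bar>" "24 * b"] h H b_nonneg
      by (intro mult_right_mono) (auto simp: cell_def)
    moreover have "H * (24 * b)\<^sup>2 + (24 * b) * (real (k + 22) * (H * (24 * b))) = H * (24 * b)\<^sup>2 * (real k + 23)"
      by (simp add: power2_eq_square algebra_simps)
    ultimately show "\<bar>avg ?B (e r y) + (avg ?B (\<lambda>s. h r y s * f' (total s)) - avg ?B (h r y) * ?m)\<bar>
        \<le> H * (24 * b)\<^sup>2 * (real k + 23)" by linarith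
  qed
qed

text \<open>
  To first order, fixing a few values shifts \<open>E f(M)\<close> as if \<open>M\<close> were translated by the shift of its mean.
\<close>

lemma response:
  assumes s0: "s0 \<in> D" and A: "finite A" "card A \<le> k"
  shows "\<bar>(avg (cell s0 A) (\<lambda>s. f (total s)) - avg D (\<lambda>s. f (total s))) -
      (avg (cell s0 A) total - avg D total) * avg D (\<lambda>s. f' (total s))\<bar>
    \<le> real (card A) * (H * (24 * b)\<^sup>2 * (real k + 23))"
  using A
proof (induction A rule: finite_induct)
  case (insert q A)
  let ?E = "H * (24 * b)\<^sup>2 * (real k + 23)"
  have IH: "\<bar>(avg (cell s0 A) (\<lambda>s. f (total s)) - avg D (\<lambda>s. f (total s))) -
      (avg (cell s0 A) total - avg D total) * avg D (\<lambda>s. f' (total s))\<bar> \<le> real (card A) * ?E"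
    using insert by simp
  have card: "real (card (insert q A)) * ?E = real (card A) * ?E + ?E" "?E \<ge> 0"
    using insert H by (simp_all add: algebra_simps)
  show ?case
  proof (cases "q \<in> {1..n}")
    case True
    have "card A \<le> k" using insert by simp
    from response_insert[OF s0 True insert(2) insert(1) this] IH show ?thesis
      unfolding card(1) left_diff_distrib by linarith
  next
    case False
    then show ?thesis using IH card cell_insert_outside[OF s0 False, of A] by simp
  qed
qed (simp add: cell_empty)

text \<open>
  Write \<open>M - m\<close> as the sum of the centred window functions and condition on each window.  The shift
  of \<open>E f(M)\<close> is proportional to the shift of \<open>E M\<close> with the factor \<open>E f'(M)\<close>, which is the same for all
  windows, and the choice \<open>f = id\<close> identifies the remaining sum as the variance.
\<close>

lemma stein_identity:
  "\<bar>avg D (\<lambda>s. (total s - avg D total) * f (total s)) -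
     avg D (\<lambda>s. (total s - avg D total)\<^sup>2) * avg D (\<lambda>s. f' (total s))\<bar>
   \<le> real n * (216 * b * H * (24 * b)\<^sup>2)"
proof -
  let ?m = "avg D (\<lambda>s. f' (total s))"
  have scale: "2 * b * (4 * (H * x * 27)) = 216 * b * H * x" for x
    by algebra
  have factor: "x * u - x * v * w = x * (u - v * w)" for x u v w :: real
    by (simp add: algebra_simps)
  have eq: "avg D (\<lambda>s. (total s - avg D total) * f (total s)) - avg D (\<lambda>s. (total s - avg D total)\<^sup>2) * ?m =
      (\<Sum>p\<in>{1..n}. avg D (\<lambda>s. (g p s - avg D (g p)) *
        ((avg (cell s (window p)) (\<lambda>s. f (total s)) - avg D (\<lambda>s. f (total s))) -
         (avg (cell s (window p)) total - avg D total) * ?m)))"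
    unfolding variance_total centered_total sum_distrib_right sum_subtractf[symmetric]
    unfolding avg_window[of _ "\<lambda>s. f (total s)"] avg_window[of _ total] avg_mult_right[symmetric] avg_diff[symmetric]
    by (simp only: factor)
  have "\<bar>\<Sum>p\<in>{1..n}. avg D (\<lambda>s. (g p s - avg D (g p)) *
        ((avg (cell s (window p)) (\<lambda>s. f (total s)) - avg D (\<lambda>s. f (total s))) -
         (avg (cell s (window p)) total - avg D total) * ?m))\<bar> \<le> (\<Sum>p\<in>{1..n}. 2 * b * (4 * (H * (24 * b)\<^sup>2 * 27)))"
  proof (rule order_trans[OF sum_abs sum_mono])
    fix p
    show "\<bar>avg D (\<lambda>s. (g p s - avg D (g p)) *
        ((avg (cell s (window p)) (\<lambda>s. f (total s)) - avg D (\<lambda>s. f (total s))) -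
         (avg (cell s (window p)) total - avg D total) * ?m))\<bar> \<le> 2 * b * (4 * (H * (24 * b)\<^sup>2 * 27))"
    proof (intro avg_bound finite_D nonempty)
      fix s assume s: "s \<in> D"
      have "\<bar>(avg (cell s (window p)) (\<lambda>s. f (total s)) - avg D (\<lambda>s. f (total s))) -
         (avg (cell s (window p)) total - avg D total) * ?m\<bar> \<le> real (card (window p)) * (H * (24 * b)\<^sup>2 * (real 4 + 23))"
        by (rule response[OF s card_window])
      also have "\<dots> \<le> 4 * (H * (24 * b)\<^sup>2 * 27)"
        using card_window(2)[of p] H by (intro mult_mono) auto
      finally show "\<bar>(g p s - avg D (g p)) *
        ((avg (cell s (window p)) (\<lambda>s. f (total s)) - avg D (\<lambda>s. f (total s))) -
         (avg (cell s (window p)) total - avg D total) * ?m)\<bar> \<le> 2 * b * (4 * (H * (24 * b)\<^sup>2 * 27))"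
        unfolding abs_mult using centered_bound[of p s] b_nonneg by (intro mult_mono) auto
    qed
  qed
  also have "\<dots> = real (card {1..n}) * (2 * b * (4 * (H * (24 * b)\<^sup>2 * 27)))"
    by (rule sum_constant)
  also have "\<dots> = real n * (216 * b * H * (24 * b)\<^sup>2)"
    using scale[of "(24 * b)\<^sup>2"] by (simp only: card_atLeastAtMost diff_Suc_1)
  finally show ?thesis unfolding eq .
qed

end

lemma variance_bound: "avg D (\<lambda>s. (total s - avg D total)\<^sup>2) \<le> real n * (192 * b\<^sup>2)"
proof -
  have "avg D (\<lambda>s. (total s - avg D total)\<^sup>2) =
      (\<Sum>p\<in>{1..n}. avg D (\<lambda>s. (g p s - avg D (g p)) * (avg (cell s (window p)) total - avg D total)))"
    unfolding variance_total centered_total by (intro sum.cong refl avg_window)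
  also have "\<dots> \<le> (\<Sum>p\<in>{1..n}. 2 * b * (4 * (24 * b)))"
  proof (rule sum_mono)
    fix p
    have "\<bar>avg D (\<lambda>s. (g p s - avg D (g p)) * (avg (cell s (window p)) total - avg D total))\<bar> \<le> 2 * b * (4 * (24 * b))"
    proof (intro avg_bound finite_D nonempty)
      fix s assume s: "s \<in> D"
      have "\<bar>avg (cell s (window p)) total - avg D total\<bar> \<le> real (card (window p)) * (24 * b)"
        using s b_nonneg by (intro avg_cell_lipschitz move_lipschitz_total card_window) auto
      also have "\<dots> \<le> 4 * (24 * b)" using card_window(2)[of p] b_nonneg by (intro mult_right_mono) auto
      finally show "\<bar>(g p s - avg D (g p)) * (avg (cell s (window p)) total - avg D total)\<bar> \<le> 2 * b * (4 * (24 * b))"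
        unfolding abs_mult using centered_bound[of p s] b_nonneg by (intro mult_mono) auto
    qed
    then show "avg D (\<lambda>s. (g p s - avg D (g p)) * (avg (cell s (window p)) total - avg D total)) \<le> 2 * b * (4 * (24 * b))"
      by linarith
  qed
  also have "\<dots> = real n * (192 * b\<^sup>2)" by (simp add: power2_eq_square)
  finally show ?thesis .
qed

end

section \<open>Smoothed central limit theorem\<close>

context local_functional
begin

text \<open>
  The function \<open>u(t) = E \<Phi>((y - t(M - m))/(s2 + (1 - t\<^sup>2)v)\<^sup>1\<^sup>/\<^sup>2)\<close> joins the two sides.  By the heat equation
  \<open>u'(t)\<close> is the defect of the Stein identity for \<open>f(M) = - gauss(y - t(M - m))\<close>.  The smoothing never has
  variance less than \<open>s2\<close>, which bounds the second derivative of \<open>f\<close> by a multiple of \<open>s2\<^sup>-\<^sup>3\<^sup>/\<^sup>2\<close>.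
\<close>

lemma gaussian_smoothing_normal:
  assumes s2: "s2 > 0"
  defines "m \<equiv> avg D total" and "v \<equiv> avg D (\<lambda>s. (total s - avg D total)\<^sup>2)"
  shows "\<bar>avg D (\<lambda>s. Phi ((y - (total s - m)) / sqrt s2)) - Phi (y / sqrt (s2 + v))\<bar>
    \<le> real n * (648 * b * (24 * b)\<^sup>2) / (s2 * sqrt s2)"
proof -
  have v0: "v \<ge> 0" unfolding v_def avg_def by (intro divide_nonneg_nonneg sum_nonneg) auto
  define N where "N s = total s - m" for s
  define \<tau> where "\<tau> t = s2 + (1 - t\<^sup>2) * v" for t
  define u where "u t = avg D (\<lambda>s. Phi ((y - t * N s) / sqrt (\<tau> t)))" for t
  define u' where "u' t = avg D (\<lambda>s. gauss (\<tau> t) (y - t * N s) * (- N s - (y - t * N s) * (- 2 * t * v) / (2 * \<tau> t)))" for t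
  have \<tau>: "\<tau> t \<ge> s2" "\<tau> t > 0" if "0 \<le> t" "t \<le> 1" for t
  proof -
    have "t\<^sup>2 \<le> 1" using that by (simp add: power_le_one)
    then have "0 \<le> (1 - t\<^sup>2) * v" using v0 by simp
    then show "\<tau> t \<ge> s2" "\<tau> t > 0" using s2 by (auto simp: \<tau>_def)
  qed
  have d\<tau>: "(\<tau> has_real_derivative - 2 * t * v) (at t)" for t
    unfolding \<tau>_def by (auto intro!: derivative_eq_intros)
  have du: "(u has_real_derivative u' t) (at t)" if t: "0 \<le> t" "t \<le> 1" for t
    unfolding u_def u'_def avg_def
  proof (intro DERIV_cdivide DERIV_sum)
    fix s
    have "((\<lambda>t. y - t * N s) has_real_derivative - N s) (at t)"
      by (auto intro!: derivative_eq_intros)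
    from DERIV_Phi_curve[OF this d\<tau> \<tau>(2)[OF t]]
    show "((\<lambda>t. Phi ((y - t * N s) / sqrt (\<tau> t))) has_real_derivative
      gauss (\<tau> t) (y - t * N s) * (- N s - (y - t * N s) * (- 2 * t * v) / (2 * \<tau> t))) (at t)" .
  qed
  obtain t where t: "0 < t" "t < 1" "u 1 - u 0 = (1 - 0) * u' t"
    using MVT2[of 0 1 u u'] du by auto
  define T where "T = \<tau> t"
  have T: "T \<ge> s2" "T > 0" using \<tau>[of t] t by (auto simp: T_def)
  define G where "G x = - (x / T) * gauss T x" for x
  define f where "f M = - gauss T (y - t * (M - m))" for M
  define f' where "f' M = t * G (y - t * (M - m))" for M
  define H where "H = 3 / (s2 * sqrt s2)"
  have inner: "((\<lambda>M. y - t * (M - m)) has_real_derivative - t) (at M)" for M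
    by (auto intro!: derivative_eq_intros)
  have f: "(f has_real_derivative f' M) (at M)" for M
    unfolding f_def f'_def G_def
    by (rule DERIV_cong[OF DERIV_minus[OF DERIV_chain2[OF DERIV_gauss[OF T(2)] inner]]]) simp
  have "3 / (T * sqrt T) \<le> H"
    unfolding H_def using T s2 by (intro divide_left_mono mult_mono mult_pos_pos) auto
  then have Gb: "\<bar>(x\<^sup>2 / T\<^sup>2 - 1 / T) * gauss T x\<bar> \<le> H" for x
    using gauss_deriv_bounds(2)[OF T(2), of x] by linarith
  have "\<bar>G x - G z\<bar> \<le> H * \<bar>x - z\<bar>" for x z
    using deriv_bound_lipschitz[of G "\<lambda>x. (x\<^sup>2 / T\<^sup>2 - 1 / T) * gauss T x" H x z] DERIV_gauss2[OF T(2)] Gb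
    unfolding G_def by blast
  note Glip = this
  have H0: "H \<ge> 0" using s2 by (simp add: H_def)
  have f'_lip: "\<bar>f' a - f' c\<bar> \<le> H * \<bar>a - c\<bar>" for a c
  proof -
    have "\<bar>f' a - f' c\<bar> = t * \<bar>G (y - t * (a - m)) - G (y - t * (c - m))\<bar>"
      unfolding f'_def right_diff_distrib[symmetric] abs_mult using t by simp
    also have "\<dots> \<le> 1 * (H * \<bar>(y - t * (a - m)) - (y - t * (c - m))\<bar>)"
      by (intro mult_mono Glip) (use t in auto)
    also have "\<bar>(y - t * (a - m)) - (y - t * (c - m))\<bar> = t * \<bar>a - c\<bar>"
    proof -
      have "(y - t * (a - m)) - (y - t * (c - m)) = - (t * (a - c))" by (simp add: algebra_simps)
      then show ?thesis using t by (simp add: abs_mult)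
    qed
    also have "1 * (H * (t * \<bar>a - c\<bar>)) \<le> H * \<bar>a - c\<bar>"
    proof -
      have "t * \<bar>a - c\<bar> \<le> \<bar>a - c\<bar>" using t by (intro mult_left_le_one_le) auto
      then show ?thesis using H0 unfolding mult_1 by (rule mult_left_mono)
    qed
    finally show ?thesis .
  qed
  have "u' t = avg D (\<lambda>s. (total s - avg D total) * f (total s)) - v * avg D (\<lambda>s. f' (total s))"
  proof -
    have pt: "gauss T x * (- N - x * (- 2 * t * v) / (2 * T)) = N * (- gauss T x) - v * (t * (- (x / T) * gauss T x))"
      for N x using T by (simp add: field_simps)
    show ?thesis
      unfolding u'_def T_def[symmetric] pt avg_diff
      by (simp only: f_def f'_def G_def N_def m_def avg_mult_left[of D v])
  qed
  then have "\<bar>u' t\<bar> \<le> real n * (216 * b * H * (24 * b)\<^sup>2)"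
    using stein_identity[of f f' H, OF f f'_lip H0] by (simp add: v_def)
  also have "\<dots> = real n * (648 * b * (24 * b)\<^sup>2) / (s2 * sqrt s2)"
    unfolding H_def by simp
  finally have "\<bar>u 1 - u 0\<bar> \<le> real n * (648 * b * (24 * b)\<^sup>2) / (s2 * sqrt s2)" using t by simp
  moreover have "u 0 = Phi (y / sqrt (s2 + v))"
    using finite_D nonempty by (simp add: u_def \<tau>_def avg_const)
  moreover have "u 1 = avg D (\<lambda>s. Phi ((y - (total s - m)) / sqrt s2))"
    by (simp add: u_def \<tau>_def N_def)
  ultimately show ?thesis by simp
qed

end

section \<open>Descents and free swaps\<close>

definition descent :: "(nat \<Rightarrow> nat) \<Rightarrow> nat \<Rightarrow> real" where
  "descent s p = of_bool (s p > s (p + 1))"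

definition descent_count :: "nat \<Rightarrow> (nat \<Rightarrow> nat) \<Rightarrow> real" where
  "descent_count n s = (\<Sum>p\<in>{1..<n}. descent s p)"

text \<open>
  The change in the number of descents caused by exchanging the entries at \<open>p\<close> and \<open>p + 1\<close>.
\<close>

definition swap_effect :: "(nat \<Rightarrow> nat) \<Rightarrow> nat \<Rightarrow> real" where
  "swap_effect s p =
     (of_bool (s (p - 1) > s (p + 1)) + of_bool (s (p + 1) > s p) + of_bool (s p > s (p + 2))) -
     (of_bool (s (p - 1) > s p) + of_bool (s p > s (p + 1)) + of_bool (s (p + 1) > s (p + 2)))"

lemma swap_effect_bound: "\<bar>swap_effect s p\<bar> \<le> 3"
  by (simp add: swap_effect_def)

lemma swap_effect_cases:
  assumes "s p \<noteq> s (p + 1)"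
  shows "swap_effect s p = 0 \<or> swap_effect s p = 1 \<or> swap_effect s p = - 1"
  using assms unfolding swap_effect_def by (cases "s p" "s (p + 1)" rule: linorder_cases) auto

lemma descent_count_swap:
  assumes "2 \<le> p" "p + 2 \<le> n"
  shows "descent_count n (s \<circ> swap p (p + 1)) = descent_count n s + swap_effect s p"
proof -
  let ?t = "s \<circ> swap p (p + 1)"
  have t: "?t a = s a" if "a \<noteq> p" "a \<noteq> p + 1" for a using that by simp
  have t2: "?t p = s (p + 1)" "?t (p + 1) = s p" by simp_all
  have "descent_count n ?t - descent_count n s = (\<Sum>i\<in>{1..<n}. descent ?t i - descent s i)"
    by (simp add: descent_count_def sum_subtractf)
  also have "\<dots> = (\<Sum>i\<in>{p - 1, p, p + 1}. descent ?t i - descent s i)"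
  proof (rule sum.mono_neutral_right)
    show "\<forall>i\<in>{1..<n} - {p - 1, p, p + 1}. descent ?t i - descent s i = 0"
    proof
      fix i assume "i \<in> {1..<n} - {p - 1, p, p + 1}"
      then have "i \<noteq> p" "i \<noteq> p + 1" "i + 1 \<noteq> p" "i + 1 \<noteq> p + 1" by auto
      then show "descent ?t i - descent s i = 0"
        unfolding descent_def using t[of i] t[of "i + 1"] by simp
    qed
  qed (use assms in auto)
  also have "\<dots> = (descent ?t (p - 1) - descent s (p - 1)) + (descent ?t p - descent s p) +
      (descent ?t (p + 1) - descent s (p + 1))"
  proof -
    have "p - 1 \<notin> {p, p + 1}" "p \<notin> {p + 1}" using assms by auto
    then show ?thesis by (simp only: sum.insert finite.insertI finite.emptyI sum.empty not_False_eq_True) simp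
  qed
  also have "\<dots> = swap_effect s p"
  proof -
    have "p - 1 + 1 = p" "p + 1 + 1 = p + 2" using assms by auto
    moreover have "?t (p - 1) = s (p - 1)" "?t (p + 2) = s (p + 2)" using assms by (auto intro!: t)
    ultimately show ?thesis unfolding descent_def swap_effect_def t2 by simp
  qed
  finally show ?thesis by simp
qed

text \<open>
  With entries \<open>x, a, c, y\<close>, exchanging \<open>a\<close> and \<open>c\<close> has no effect only if exactly one of \<open>x\<close> and \<open>y\<close> lies
  between \<open>a\<close> and \<open>c\<close>.  Exchanging that one with its neighbour among \<open>a\<close> and \<open>c\<close> repairs this.
\<close>

lemma some_rearrangement_effective:
  assumes "distinct [s (p - 1), s p, s (p + 1), s (p + 2)]" "p \<ge> 1"
  shows "swap_effect s p \<noteq> 0 \<or> swap_effect (s \<circ> swap (p - 1) p) p \<noteq> 0 \<or>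
    swap_effect (s \<circ> swap (p + 1) (p + 2)) p \<noteq> 0"
proof -
  have *: "p - 1 \<noteq> p" "p - 1 \<noteq> p + 1" "p - 1 \<noteq> p + 2" using assms by auto
  obtain x a c y where v: "s (p - 1) = x" "s p = a" "s (p + 1) = c" "s (p + 2) = y" by blast
  have d: "x \<noteq> a" "x \<noteq> c" "x \<noteq> y" "a \<noteq> c" "a \<noteq> y" "c \<noteq> y" using assms(1) unfolding v by auto
  have 1: "(s \<circ> swap (p - 1) p) (p - 1) = a" "(s \<circ> swap (p - 1) p) p = x"
    "(s \<circ> swap (p - 1) p) (p + 1) = c" "(s \<circ> swap (p - 1) p) (p + 2) = y"
    using * v by (simp_all add: transpose_apply_other)
  have 2: "(s \<circ> swap (p + 1) (p + 2)) (p - 1) = x" "(s \<circ> swap (p + 1) (p + 2)) p = a"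
    "(s \<circ> swap (p + 1) (p + 2)) (p + 1) = y" "(s \<circ> swap (p + 1) (p + 2)) (p + 2) = c"
    using * v by (simp_all add: transpose_apply_other)
  show ?thesis
    unfolding swap_effect_def 1 2 v using d
    by (cases "x < a"; cases "x < c"; cases "x < y"; cases "a < c"; cases "a < y"; cases "c < y"; simp)
qed

context position_value_blocks
begin

text \<open>
  Divisibility by 3 keeps the pair \<open>{p, p + 1}\<close> of one site out of the window \<open>{p - 1..p + 2}\<close> of any other,
  so exchanges at different sites commute and do not alter each other's effects.
\<close>

definition sites :: "nat set" where
  "sites = {p. 2 \<le> p \<and> p + 2 \<le> n \<and> p mod 3 = 0 \<and> row (p - 1) = row p \<and> row (p + 1) = row p \<and> row (p + 2) = row p}"

lemma finite_sites: "finite sites"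
  by (rule finite_subset[of _ "{..n}"]) (auto simp: sites_def)

lemma avg_swap_positions:
  assumes "q \<in> {1..n}" "r \<in> {1..n}" "row q = row r"
  shows "avg D (\<lambda>s. F (s \<circ> swap q r)) = avg D F"
proof -
  have "(\<Sum>s\<in>D. F (s \<circ> swap q r)) = (\<Sum>s\<in>D. F s)"
    by (rule sum.reindex_bij_witness[where i = "\<lambda>s. s \<circ> swap q r" and j = "\<lambda>s. s \<circ> swap q r"])
      (use swap_positions[OF _ assms] in \<open>auto simp: comp_assoc\<close>)
  then show ?thesis by (simp add: avg_def)
qed

definition free_count :: "nat set \<Rightarrow> (nat \<Rightarrow> nat) \<Rightarrow> nat" where
  "free_count S s = card {p \<in> S. swap_effect s p \<noteq> 0}"

text \<open>
  Descents are counted twice, so that an effective swap contributes a fair sign and shifts the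
  centre by \<open>\<plusminus>1\<close>: the values 0 and \<open>2\<delta>\<close> are \<open>\<delta> \<plusminus> 1\<close>.
\<close>

definition centre :: "nat set \<Rightarrow> (nat \<Rightarrow> nat) \<Rightarrow> real" where
  "centre S s = 2 * descent_count n s + (\<Sum>p\<in>S. swap_effect s p)"

lemma swap_effect_other_site:
  assumes "p \<in> sites" "p' \<in> sites" "p \<noteq> p'"
  shows "swap_effect (s \<circ> swap p' (p' + 1)) p = swap_effect s p"
proof -
  have "p mod 3 = 0" "p' mod 3 = 0" "2 \<le> p" "2 \<le> p'" using assms by (auto simp: sites_def)
  then have "p - 1 \<noteq> p'" "p \<noteq> p'" "p + 1 \<noteq> p'" "p + 2 \<noteq> p'"
    "p - 1 \<noteq> p' + 1" "p \<noteq> p' + 1" "p + 1 \<noteq> p' + 1" "p + 2 \<noteq> p' + 1"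
    using assms(3) by presburger+
  then show ?thesis by (simp add: swap_effect_def transpose_apply_other)
qed

text \<open>
  Sites are added one at a time.  Averaging over the swap at \<open>p\<close>, which preserves the uniform law, gives
  the mean of the iterated coin average at \<open>centre S s\<close> and at \<open>centre S s + 2\<delta>\<close>, where \<open>\<delta>\<close> is the effect of the swap; for \<open>\<delta> = \<plusminus>1\<close>
  this is a coin average around the new centre \<open>centre S s + \<delta>\<close>.
\<close>

lemma coin_decomposition:
  assumes "finite S" "S \<subseteq> sites"
  shows "avg D (\<lambda>s. \<psi> (2 * descent_count n s)) = avg D (\<lambda>s. (coin ^^ free_count S s) \<psi> (centre S s))"
  using assms
proof (induction S rule: finite_induct)
  case empty
  then show ?case by (simp add: free_count_def centre_def)
next
  case (insert p S)
  let ?X = "\<lambda>s. (coin ^^ free_count S s) \<psi> (centre S s)"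
  let ?\<tau> = "swap p (p + 1)"
  have p: "p \<in> sites" "2 \<le> p" "p + 2 \<le> n" "row p = row (p + 1)" using insert by (auto simp: sites_def)
  have pn: "p \<in> {1..n}" "p + 1 \<in> {1..n}" using p by auto
  have "avg D (\<lambda>s. \<psi> (2 * descent_count n s)) = avg D ?X" using insert by simp
  also have "\<dots> = avg D (\<lambda>s. (?X s + ?X (s \<circ> ?\<tau>)) / 2)"
    unfolding avg_divide avg_add using avg_swap_positions[OF pn p(4), of ?X] by simp
  also have "\<dots> = avg D (\<lambda>s. (coin ^^ free_count (insert p S) s) \<psi> (centre (insert p S) s))"
  proof (rule avg_cong)
    fix s assume s: "s \<in> D"
    have eff: "swap_effect (s \<circ> ?\<tau>) p' = swap_effect s p'" if "p' \<in> S" for p'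
      using swap_effect_other_site[of p' p s] insert that p(1) by auto
    have fc: "free_count S (s \<circ> ?\<tau>) = free_count S s"
      unfolding free_count_def using eff by (intro arg_cong[where f = card]) auto
    have ce: "centre S (s \<circ> ?\<tau>) = centre S s + 2 * swap_effect s p"
      unfolding centre_def using descent_count_swap[OF p(2,3), of s] eff by simp
    have ci: "centre (insert p S) s = centre S s + swap_effect s p"
      using insert by (simp add: centre_def)
    have fi: "free_count (insert p S) s = free_count S s + of_bool (swap_effect s p \<noteq> 0)"
    proof (cases "swap_effect s p = 0")
      case True
      then have "{p' \<in> insert p S. swap_effect s p' \<noteq> 0} = {p' \<in> S. swap_effect s p' \<noteq> 0}" by auto
      then show ?thesis using True by (simp add: free_count_def)
    next
      case False
      then have "{p' \<in> insert p S. swap_effect s p' \<noteq> 0} = insert p {p' \<in> S. swap_effect s p' \<noteq> 0}" by auto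
      then show ?thesis using False insert by (simp add: free_count_def)
    qed
    have "s p \<noteq> s (p + 1)" using perm_inj[OF s] by simp
    from swap_effect_cases[of s p, OF this]
    show "(?X s + ?X (s \<circ> ?\<tau>)) / 2 = (coin ^^ free_count (insert p S) s) \<psi> (centre (insert p S) s)"
      unfolding fc ce ci fi by (auto simp: coin_def[of "(coin ^^ _) _"] add.commute)
  qed
  finally show ?case .
qed

definition centre_part :: "nat \<Rightarrow> (nat \<Rightarrow> nat) \<Rightarrow> real" where
  "centre_part p s = (if p < n then 2 * descent s p else 0) + (if p \<in> sites then swap_effect s p else 0)"

definition free_part :: "nat \<Rightarrow> (nat \<Rightarrow> nat) \<Rightarrow> real" where
  "free_part p s = (if p \<in> sites \<and> swap_effect s p \<noteq> 0 then 1 else 0)"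

lemma window_members: "p - 1 \<in> window p" "p \<in> window p" "p + 1 \<in> window p" "p + 2 \<in> window p"
  by (auto simp: window_def)

lemma swap_effect_local: "(\<And>a. a \<in> window p \<Longrightarrow> s a = t a) \<Longrightarrow> swap_effect s p = swap_effect t p"
  unfolding swap_effect_def using window_members[of p] by simp

lemma centre_local_functional: "local_functional n row col D centre_part 5"
proof unfold_locales
  fix p and s t :: "nat \<Rightarrow> nat" assume st: "\<And>a. a \<in> window p \<Longrightarrow> s a = t a"
  have "descent s p = descent t p" unfolding descent_def using st window_members[of p] by simp
  then show "centre_part p s = centre_part p t"
    unfolding centre_part_def using swap_effect_local[OF st] by simp
next
  fix p s
  have "\<bar>descent s p\<bar> \<le> 1" by (simp add: descent_def)
  then show "\<bar>centre_part p s\<bar> \<le> 5"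
    using swap_effect_bound[of s p] unfolding centre_part_def by auto
qed

lemma free_local_functional: "local_functional n row col D free_part 1"
proof unfold_locales
  fix p and s t :: "nat \<Rightarrow> nat" assume "\<And>a. a \<in> window p \<Longrightarrow> s a = t a"
  then show "free_part p s = free_part p t"
    unfolding free_part_def using swap_effect_local[of p s t] by simp
qed (simp add: free_part_def)

lemma sites_subset: "sites \<subseteq> {1..n}"
  by (auto simp: sites_def)

lemma centre_total: "local_functional.total n centre_part s = centre sites s"
proof -
  have "(\<Sum>p\<in>{1..n}. if p < n then 2 * descent s p else 0) = (\<Sum>p\<in>{1..<n}. 2 * descent s p)"
    by (rule sum.mono_neutral_cong_right) auto
  moreover have "(\<Sum>p\<in>{1..n}. if p \<in> sites then swap_effect s p else 0) = (\<Sum>p\<in>sites. swap_effect s p)"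
    by (rule sum.mono_neutral_cong_right) (use sites_subset in auto)
  ultimately show ?thesis
    unfolding local_functional.total_def[OF centre_local_functional] centre_part_def centre_def descent_count_def
    by (simp add: sum.distrib sum_distrib_left)
qed

lemma free_total: "local_functional.total n free_part s = real (free_count sites s)"
proof -
  have "(\<Sum>p\<in>{1..n}. free_part p s) = (\<Sum>p\<in>{p \<in> sites. swap_effect s p \<noteq> 0}. 1)"
    by (rule sum.mono_neutral_cong_right) (use sites_subset in \<open>auto simp: free_part_def\<close>)
  then show ?thesis
    unfolding local_functional.total_def[OF free_local_functional] free_count_def by simp
qed

text \<open>
  A site is effective with probability at least \<open>1/3\<close>: of any permutation and its two rearrangements by
  \<open>some_rearrangement_effective\<close> at least one is effective, and all three are uniformly distributed.
\<close>

lemma avg_free_count: "avg D (\<lambda>s. real (free_count sites s)) \<ge> real (card sites) / 3"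
proof -
  have third: "avg D (free_part p) \<ge> 1 / 3" if p: "p \<in> sites" for p
  proof -
    have pp: "p - 1 \<in> {1..n}" "p \<in> {1..n}" "p + 1 \<in> {1..n}" "p + 2 \<in> {1..n}"
      "row (p - 1) = row p" "row (p + 1) = row (p + 2)" using p by (auto simp: sites_def)
    have "1 = avg D (\<lambda>s. 1)" using finite_D nonempty by (simp add: avg_const)
    also have "\<dots> \<le> avg D (\<lambda>s. free_part p s + free_part p (s \<circ> swap (p - 1) p) + free_part p (s \<circ> swap (p + 1) (p + 2)))"
    proof (rule avg_mono)
      fix s assume "s \<in> D"
      then have "distinct [s (p - 1), s p, s (p + 1), s (p + 2)]" "p \<ge> 1"
        using pp perm_inj[of s] by auto
      from some_rearrangement_effective[OF this]
      show "1 \<le> free_part p s + free_part p (s \<circ> swap (p - 1) p) + free_part p (s \<circ> swap (p + 1) (p + 2))"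
        using p by (auto simp: free_part_def)
    qed
    also have "\<dots> = 3 * avg D (free_part p)"
      unfolding avg_add using avg_swap_positions[OF pp(1,2,5), of "free_part p"]
        avg_swap_positions[OF pp(3,4,6), of "free_part p"] by simp
    finally show ?thesis by simp
  qed
  have "real (card sites) / 3 = (\<Sum>p\<in>sites. 1 / 3)" by simp
  also have "\<dots> \<le> (\<Sum>p\<in>sites. avg D (free_part p))" by (intro sum_mono third)
  also have "\<dots> \<le> (\<Sum>p\<in>{1..n}. avg D (free_part p))"
    by (rule sum_mono2) (use sites_subset in \<open>auto simp: avg_def free_part_def sum_nonneg\<close>)
  also have "\<dots> = avg D (\<lambda>s. real (free_count sites s))"
    unfolding free_total[symmetric] local_functional.total_def[OF free_local_functional] avg_sum ..
  finally show ?thesis .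
qed

end

section \<open>Normal approximation of the number of descents\<close>

context position_value_blocks
begin

lemma avg_abs_le_sqrt: "avg D (\<lambda>s. \<bar>F s\<bar>) \<le> sqrt (avg D (\<lambda>s. (F s)\<^sup>2))"
proof (rule real_le_rsqrt)
  let ?a = "avg D (\<lambda>s. \<bar>F s\<bar>)"
  have "0 \<le> avg D (\<lambda>s. (\<bar>F s\<bar> - ?a)\<^sup>2)"
    unfolding avg_def[of D "\<lambda>s. (_ s)\<^sup>2"] by (intro divide_nonneg_nonneg sum_nonneg) auto
  also have "(\<lambda>s. (\<bar>F s\<bar> - ?a)\<^sup>2) = (\<lambda>s. (F s)\<^sup>2 - 2 * ?a * \<bar>F s\<bar> + ?a\<^sup>2)"
    by (simp add: power2_diff fun_eq_iff)
  also have "avg D \<dots> = avg D (\<lambda>s. (F s)\<^sup>2) - 2 * ?a * ?a + ?a\<^sup>2"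
    using finite_D nonempty by (simp add: avg_add avg_diff avg_mult_left avg_const)
  finally show "?a\<^sup>2 \<le> avg D (\<lambda>s. (F s)\<^sup>2)" by (simp add: power2_eq_square)
qed

text \<open>
  The case of the functions \<open>x\<close> and \<open>(x - m)\<^sup>2\<close> in the coin decomposition.
\<close>

lemma descent_count_moments:
  defines "m \<equiv> avg D (\<lambda>s. 2 * descent_count n s)"
  shows "avg D (centre sites) = m"
    and "avg D (\<lambda>s. (2 * descent_count n s - m)\<^sup>2) =
      avg D (\<lambda>s. real (free_count sites s)) + avg D (\<lambda>s. (centre sites s - m)\<^sup>2)"
proof -
  show "avg D (centre sites) = m"
    using coin_decomposition[OF finite_sites subset_refl, of "\<lambda>x. x"]
    by (simp add: m_def coin_power_identity)
  show "avg D (\<lambda>s. (2 * descent_count n s - m)\<^sup>2) =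
      avg D (\<lambda>s. real (free_count sites s)) + avg D (\<lambda>s. (centre sites s - m)\<^sup>2)"
    using coin_decomposition[OF finite_sites subset_refl, of "\<lambda>x. (x - m)\<^sup>2"]
    by (simp add: coin_power_square avg_add)
qed

text \<open>
  First the coins are replaced by a normal variable of the constant variance \<open>s2 = E K\<close>, the fluctuation of
  \<open>K\<close> being of order \<open>n\<^sup>1\<^sup>/\<^sup>2\<close>; then the smoothed law of the centre is compared with a normal law.
\<close>

lemma descent_count_normal_approximation:
  assumes sites: "real n \<le> 4 * real (card sites)" and n: "n \<ge> 1"
  defines "m \<equiv> avg D (\<lambda>s. 2 * descent_count n s)"
    and "V \<equiv> avg D (\<lambda>s. (2 * descent_count n s - avg D (\<lambda>s. 2 * descent_count n s))\<^sup>2)"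
  shows "V > 0"
    and "\<bar>avg D (\<lambda>s. of_bool (2 * descent_count n s \<le> z)) - Phi ((z - m) / sqrt V)\<bar>
      \<le> 3000000000 / sqrt (real n)"
proof -
  interpret M: local_functional n row col D centre_part 5 by (rule centre_local_functional)
  interpret K: local_functional n row col D free_part 1 by (rule free_local_functional)
  have Mt: "M.total = centre sites" using centre_total by blast
  have Kt: "K.total = (\<lambda>s. real (free_count sites s))" using free_total by blast
  define s2 where "s2 = avg D (\<lambda>s. real (free_count sites s))"
  define v where "v = avg D (\<lambda>s. (centre sites s - m)\<^sup>2)"
  have s2n: "s2 \<ge> real n / 12" using avg_free_count sites unfolding s2_def by linarith
  then have s2: "s2 > 0" using n by (auto intro: less_le_trans)
  have v0: "v \<ge> 0" unfolding v_def avg_def by (intro divide_nonneg_nonneg sum_nonneg) auto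
  have mean: "avg D (centre sites) = m" using descent_count_moments(1) by (simp add: m_def)
  have V: "V = s2 + v" using descent_count_moments(2) by (simp add: V_def s2_def v_def m_def)
  then show "V > 0" using s2 v0 by simp
  define r where "r = sqrt (real n)"
  have r: "r > 0" "r * r = real n" using n by (simp_all add: r_def)
  have rs: "r / 4 \<le> sqrt s2"
  proof (rule real_le_rsqrt)
    \<comment> \<open>\<open>s2 \<ge> n/12\<close> gives \<open>s2 * sqrt s2 \<ge> (n/12) * (r/4)\<close>, whence the factor 48 further down\<close>
    have "(r / 4)\<^sup>2 = real n / 16" using r(2) by (simp add: power2_eq_square)
    also have "\<dots> \<le> s2" using s2n by simp
    finally show "(r / 4)\<^sup>2 \<le> s2" .
  qed
  have "avg D (\<lambda>s. of_bool (2 * descent_count n s \<le> z)) = avg D (\<lambda>s. (coin ^^ free_count sites s) step (z - centre sites s))"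
  proof -
    have "avg D (\<lambda>s. step (z - 2 * descent_count n s)) =
        avg D (\<lambda>s. (coin ^^ free_count sites s) (\<lambda>x. step (z - x)) (centre sites s))"
      by (rule coin_decomposition[OF finite_sites subset_refl])
    also have "\<dots> = avg D (\<lambda>s. (coin ^^ free_count sites s) step (z - centre sites s))"
      by (simp only: coin_power_reflect[of _ step z])
    finally show ?thesis by (simp add: step_def of_bool_def)
  qed
  then have "\<bar>avg D (\<lambda>s. of_bool (2 * descent_count n s \<le> z)) - avg D (\<lambda>s. Phi ((z - centre sites s) / sqrt s2))\<bar> \<le>
      avg D (\<lambda>s. \<bar>(coin ^^ free_count sites s) step (z - centre sites s) - Phi ((z - centre sites s) / sqrt s2)\<bar>)"
    by (simp only: avg_diff[symmetric] avg_abs_le)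
  also have "\<dots> \<le> avg D (\<lambda>s. 15000 / sqrt s2 + 2 * \<bar>real (free_count sites s) - s2\<bar> / s2)"
    by (intro avg_mono coin_power_normal_variance s2)
  also have "\<dots> = 15000 / sqrt s2 + 2 * avg D (\<lambda>s. \<bar>real (free_count sites s) - s2\<bar>) / s2"
    using finite_D nonempty by (simp add: avg_add avg_const avg_divide avg_mult_left)
  also have "\<dots> \<le> 60000 / r + 400 / r"
  proof (rule add_mono)
    have "15000 / sqrt s2 \<le> 15000 / (r / 4)" using rs r s2 by (intro divide_left_mono) auto
    then show "15000 / sqrt s2 \<le> 60000 / r" by simp
    have "avg D (\<lambda>s. \<bar>real (free_count sites s) - s2\<bar>) \<le> sqrt (avg D (\<lambda>s. (real (free_count sites s) - s2)\<^sup>2))"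
      by (rule avg_abs_le_sqrt)
    also have "\<dots> \<le> sqrt (real n * 192)"
      using K.variance_bound unfolding Kt s2_def by (intro real_sqrt_le_mono) simp
    also have "\<dots> \<le> 16 * r"
    proof (rule real_le_lsqrt)
      have "(16 * r)\<^sup>2 = 256 * real n" using r(2) by (simp add: power2_eq_square)
      then show "real n * 192 \<le> (16 * r)\<^sup>2" by simp
    qed (use r in auto)
    finally have "2 * avg D (\<lambda>s. \<bar>real (free_count sites s) - s2\<bar>) / s2 \<le> 2 * (16 * r) / (real n / 12)"
      using s2n s2 n r by (intro frac_le) auto
    also have "\<dots> = 384 / r" using r by (simp add: r(2)[symmetric])
    also have "\<dots> \<le> 400 / r" using r by (intro divide_right_mono) auto
    finally show "2 * avg D (\<lambda>s. \<bar>real (free_count sites s) - s2\<bar>) / s2 \<le> 400 / r" .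
  qed
  finally have 1: "\<bar>avg D (\<lambda>s. of_bool (2 * descent_count n s \<le> z)) - avg D (\<lambda>s. Phi ((z - centre sites s) / sqrt s2))\<bar>
      \<le> 60000 / r + 400 / r" .
  have "\<bar>avg D (\<lambda>s. Phi ((z - centre sites s) / sqrt s2)) - Phi ((z - m) / sqrt V)\<bar> \<le>
      real n * (648 * 5 * (24 * 5)\<^sup>2) / (s2 * sqrt s2)"
    using M.gaussian_smoothing_normal[OF s2, of "z - m"] unfolding Mt mean by (simp add: V v_def)
  also have "\<dots> = 46656000 * (real n / (s2 * sqrt s2))" by simp
  also have "\<dots> \<le> 46656000 * (48 / r)"
  proof (rule mult_left_mono)
    have "real n / (s2 * sqrt s2) \<le> real n / ((real n / 12) * (r / 4))"
      using s2n rs s2 r n by (intro divide_left_mono mult_mono mult_pos_pos) auto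
    also have "\<dots> = 48 / r" using n r by simp
    finally show "real n / (s2 * sqrt s2) \<le> 48 / r" .
  qed simp
  finally have 2: "\<bar>avg D (\<lambda>s. Phi ((z - centre sites s) / sqrt s2)) - Phi ((z - m) / sqrt V)\<bar> \<le> 46656000 * (48 / r)" .
  \<comment> \<open>the errors of the coin step, of replacing \<open>K\<close> by its mean, and of the smoothed limit theorem\<close>
  have "60000 / r + 400 / r + 46656000 * (48 / r) \<le> 3000000000 / r"
    using r by (simp add: add_divide_distrib[symmetric] divide_right_mono)
  then show "\<bar>avg D (\<lambda>s. of_bool (2 * descent_count n s \<le> z)) - Phi ((z - m) / sqrt V)\<bar>
      \<le> 3000000000 / sqrt (real n)"
    using 1 2 unfolding r_def[symmetric] by linarith
qed

end

section \<open>Double cosets\<close>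

definition block_index :: "nat list \<Rightarrow> nat \<Rightarrow> nat" where
  "block_index lam x = (THE i. i < length lam \<and> x \<in> block lam i)"

lemma block_index:
  assumes "sum_list lam = n" "x \<in> {1..n}"
  shows "block_index lam x < length lam \<and> x \<in> block lam (block_index lam x)"
  unfolding block_index_def by (rule theI') (use block_exists[OF assms] block_unique in blast)

lemma block_index_eq_iff:
  assumes "sum_list lam = n" "x \<in> {1..n}"
  shows "block_index lam x = i \<longleftrightarrow> x \<in> block lam i"
  using block_index[OF assms] block_unique by blast

lemma swap_parabolic:
  assumes "sum_list lam = n" "q \<in> {1..n}" "r \<in> {1..n}" "block_index lam q = block_index lam r"
  shows "swap q r \<in> parabolic n lam"
proof (rule parabolicI[OF assms(1)])
  show "swap q r permutes {1..n}" by (rule permutes_swap_id) (use assms in auto)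
  fix x j assume x: "x \<in> {1..n}" "x \<in> block lam j"
  have "q \<in> block lam j \<longleftrightarrow> r \<in> block lam j"
    using assms(4) block_index_eq_iff[OF assms(1,2)] block_index_eq_iff[OF assms(1,3)] by metis
  then show "swap q r x \<in> block lam j"
    using x by (cases "x = q"; cases "x = r") (auto simp: transpose_apply_other)
qed

lemma parabolic_comp:
  assumes "u \<in> parabolic n lam" "w \<in> parabolic n lam"
  shows "u \<circ> w \<in> parabolic n lam"
proof -
  have "(u \<circ> w) ` block lam i = block lam i" if "i < length lam" for i
  proof -
    have "(u \<circ> w) ` block lam i = u ` (w ` block lam i)" by (rule image_comp[symmetric])
    then show ?thesis using assms that by (simp add: parabolic_def)
  qed
  moreover have "u \<circ> w permutes {1..n}" using assms by (auto simp: parabolic_def intro: permutes_compose)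
  ultimately show ?thesis by (simp add: parabolic_def)
qed

lemma double_coset_blocks:
  assumes lam: "is_partition n lam" and mu: "is_partition n mu" and p: "p permutes {1..n}"
  shows "position_value_blocks n (block_index lam) (block_index mu) (double_coset n lam mu p)"
proof
  let ?D = "double_coset n lam mu p"
  have sl: "sum_list lam = n" and sm: "sum_list mu = n" using lam mu by (auto simp: is_partition_def)
  note D_eq = double_coset_eq_contingency_table[OF lam mu p]
  show perm: "s permutes {1..n}" if "s \<in> ?D" for s using that unfolding D_eq by simp
  show "?D \<noteq> {}" unfolding D_eq using p by blast
  show "s \<circ> swap q r \<in> ?D"
    if s: "s \<in> ?D" and qr: "q \<in> {1..n}" "r \<in> {1..n}" "block_index lam q = block_index lam r" for s q r
  proof -
    obtain u v where uv: "u \<in> parabolic n lam" "v \<in> parabolic n mu" "s = v \<circ> p \<circ> u"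
      using s by (auto simp: double_coset_def)
    have "u \<circ> swap q r \<in> parabolic n lam" by (intro parabolic_comp uv swap_parabolic[OF sl] qr)
    then show ?thesis using uv unfolding double_coset_def by (auto simp: comp_assoc)
  qed
  show "swap x y \<circ> s \<in> ?D"
    if s: "s \<in> ?D" and xy: "x \<in> {1..n}" "y \<in> {1..n}" "block_index mu x = block_index mu y" for s x y
  proof -
    obtain u v where uv: "u \<in> parabolic n lam" "v \<in> parabolic n mu" "s = v \<circ> p \<circ> u"
      using s by (auto simp: double_coset_def)
    have "swap x y \<circ> v \<in> parabolic n mu" by (intro parabolic_comp uv swap_parabolic[OF sm] xy)
    moreover have "swap x y \<circ> s = (swap x y \<circ> v) \<circ> p \<circ> u" by (simp add: uv(3) comp_assoc)
    ultimately show ?thesis using uv(1) unfolding double_coset_def by blast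
  qed
  show "card {x \<in> {1..n}. block_index lam x = i \<and> block_index mu (s x) = j} =
      card {x \<in> {1..n}. block_index lam x = i \<and> block_index mu (t x) = j}"
    if st: "s \<in> ?D" "t \<in> ?D" for s t i j
  proof -
    have table: "card {x \<in> {1..n}. block_index lam x = i \<and> block_index mu (w x) = j} = contingency_table lam mu w i j"
      if w: "w permutes {1..n}" for w
    proof -
      have "w x \<in> {1..n}" if "x \<in> {1..n}" for x using permutes_in_image[OF w] that by simp
      then have "{x \<in> {1..n}. block_index lam x = i \<and> block_index mu (w x) = j} = {x \<in> block lam i. w x \<in> block mu j}"
        using block_index_eq_iff[OF sl] block_index_eq_iff[OF sm] block_subset[OF sl, of i] by blast
      then show ?thesis by (simp add: contingency_table_def)
    qed
    have "contingency_table lam mu s i j = contingency_table lam mu t i j"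
    proof (cases "i < length lam \<and> j < length mu")
      case True
      then show ?thesis using st unfolding D_eq by simp
    next
      case False
      then have "block lam i = {} \<or> block mu j = {}" by (auto simp: block_def)
      then show ?thesis by (auto simp: contingency_table_def)
    qed
    then show ?thesis using table[OF perm[OF st(1)]] table[OF perm[OF st(2)]] by simp
  qed
qed

lemma block_boundary:
  assumes "sum_list lam = n" "x \<in> {1..n}" "x + 1 \<in> {1..n}" "block_index lam x \<noteq> block_index lam (x + 1)"
  shows "x \<in> (\<lambda>i. sum_list (take (Suc i) lam)) ` {..<length lam}"
proof -
  let ?i = "block_index lam x"
  have i: "?i < length lam" "x \<in> block lam ?i" using block_index[OF assms(1,2)] by auto
  have "x + 1 \<notin> block lam ?i" using assms(4) block_index_eq_iff[OF assms(1,3), of ?i] by metis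
  then have "x = sum_list (take (Suc ?i) lam)" using i(2) by (auto simp: block_def)
  then show ?thesis using i(1) by blast
qed

text \<open>
  Among the roughly \<open>n/3\<close> multiples of 3 a window is lost only if it straddles the end of one of the row
  blocks, and each end spoils at most three of them.
\<close>

lemma card_sites_ge:
  assumes pv: "position_value_blocks n (block_index lam) col D" and sl: "sum_list lam = n"
    and few: "72 * length lam \<le> n" and n: "n \<ge> 40"
  shows "real n \<le> 4 * real (card (position_value_blocks.sites n (block_index lam)))"
proof -
  interpret position_value_blocks n "block_index lam" col D by (rule pv)
  define E where "E = (\<lambda>i. sum_list (take (Suc i) lam)) ` {..<length lam}"
  \<comment> \<open>the multiples of 3 between 3 and \<open>n - 2\<close>\<close>
  define C where "C = (\<lambda>k. 3 * k) ` {1..(n - 2) div 3}"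
  have E: "finite E" "card E \<le> length lam" using card_image_le[of "{..<length lam}"] by (auto simp: E_def)
  have C: "card C = (n - 2) div 3" unfolding C_def by (subst card_image) (auto simp: inj_on_def)
  have "C - sites \<subseteq> (\<Union>e\<in>E. {e - 1..e + 1})"
  proof
    fix p assume p: "p \<in> C - sites"
    then have pr: "3 \<le> p" "p + 2 \<le> n" "p mod 3 = 0" by (auto simp: C_def)
    have edge: "x \<in> E" if "1 \<le> x" "x + 1 \<le> n" "block_index lam x \<noteq> block_index lam (x + 1)" for x
      unfolding E_def using that by (intro block_boundary[OF sl]) auto
    have eq: "p - 1 + 1 = p" "p + 1 + 1 = p + 2" using pr by auto
    have "block_index lam (p - 1) \<noteq> block_index lam p \<or> block_index lam p \<noteq> block_index lam (p + 1) \<or>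
        block_index lam (p + 1) \<noteq> block_index lam (p + 2)"
      using p pr by (auto simp: sites_def)
    then consider "p - 1 \<in> E" | "p \<in> E" | "p + 1 \<in> E"
      using edge[of "p - 1"] edge[of p] edge[of "p + 1"] pr unfolding eq by fastforce
    then have "\<exists>e\<in>E. p \<in> {e - 1..e + 1}"
    proof cases
      case 1
      then show ?thesis using pr by (intro bexI[of _ "p - 1"]) auto
    next
      case 2
      then show ?thesis by (intro bexI[of _ p]) auto
    next
      case 3
      then show ?thesis by (intro bexI[of _ "p + 1"]) auto
    qed
    then show "p \<in> (\<Union>e\<in>E. {e - 1..e + 1})" by blast
  qed
  then have "card (C - sites) \<le> card (\<Union>e\<in>E. {e - 1..e + 1})" using E(1) by (intro card_mono) auto
  also have "\<dots> \<le> (\<Sum>e\<in>E. card {e - 1..e + 1})" by (rule card_UN_le[OF E(1)])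
  also have "\<dots> \<le> (\<Sum>e\<in>E. 3)" by (intro sum_mono) auto
  also have "\<dots> \<le> 3 * length lam" using E(2) by simp
  finally have bad: "card (C - sites) \<le> 3 * length lam" .
  have "card C \<le> card ((C - sites) \<union> sites)"
    by (rule card_mono) (use finite_sites in \<open>auto simp: C_def\<close>)
  also have "\<dots> \<le> card (C - sites) + card sites" by (rule card_Un_le)
  finally have "(n - 2) div 3 \<le> 3 * length lam + card sites" using bad C by simp
  \<comment> \<open>\<open>(n - 4)/3 - 3 n/72 \<ge> n/4\<close> once \<open>n \<ge> 32\<close>\<close>
  moreover have "n \<le> 3 * ((n - 2) div 3) + 4" by presburger
  ultimately have "n \<le> 4 * card sites" using few n by linarith
  then show ?thesis by linarith
qed

lemma descent_count_eq_des: "descent_count n s = real (des n s)"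
proof -
  have "{i. 1 \<le> i \<and> i < n \<and> s i > s (i + 1)} = {1..<n} \<inter> {i. s i > s (i + 1)}" by auto
  then show ?thesis by (simp add: descent_count_def descent_def des_def sum_of_bool_eq)
qed

lemma expectation_eq_avg:
  "finite S \<Longrightarrow> S \<noteq> {} \<Longrightarrow> measure_pmf.expectation (pmf_of_set S) F = avg S F"
  by (simp add: integral_pmf_of_set avg_def)

lemma cdf_des_std_law:
  assumes "finite S" "S \<noteq> {}"
  shows "cdf (des_std_law n S) x =
    avg S (\<lambda>s. of_bool ((real (des n s) - des_mean n S) / sqrt (des_var n S) \<le> x))"
proof -
  let ?X = "\<lambda>s. (real (des n s) - des_mean n S) / sqrt (des_var n S)"
  have "cdf (des_std_law n S) x = measure (measure_pmf (pmf_of_set S)) (?X -` {..x})"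
    unfolding cdf_def des_std_law_def by (subst measure_distr) auto
  also have "\<dots> = real (card (S \<inter> (?X -` {..x}))) / real (card S)"
    by (rule measure_pmf_of_set[OF assms(2,1)])
  also have "S \<inter> (?X -` {..x}) = S \<inter> {s. ?X s \<le> x}" by auto
  finally show ?thesis using assms(1) by (simp add: avg_def sum_of_bool_eq)
qed

text \<open>
  A finite form of the theorem, with an absolute constant.
\<close>

lemma double_coset_normal_approximation:
  assumes lam: "is_partition n lam" and mu: "is_partition n mu" and D: "D \<in> double_cosets n lam mu"
    and few: "72 * length lam \<le> n" and n: "n \<ge> 40"
  shows "\<bar>cdf (des_std_law n D) x - cdf std_normal_distribution x\<bar> \<le> 3000000000 / sqrt (real n)"
proof -
  obtain p where p: "p permutes {1..n}" "D = double_coset n lam mu p" using D by (auto simp: double_cosets_def)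
  have pv: "position_value_blocks n (block_index lam) (block_index mu) D"
    unfolding p(2) by (rule double_coset_blocks[OF lam mu p(1)])
  interpret position_value_blocks n "block_index lam" "block_index mu" D by (rule pv)
  have sl: "sum_list lam = n" using lam by (simp add: is_partition_def)
  have sites: "real n \<le> 4 * real (card sites)" by (rule card_sites_ge[OF pv sl few n])
  have n1: "n \<ge> 1" using n by simp
  define m where "m = avg D (\<lambda>s. 2 * descent_count n s)"
  define V where "V = avg D (\<lambda>s. (2 * descent_count n s - m)\<^sup>2)"
  \<comment> \<open>the threshold for twice the number of descents that corresponds to the standardized threshold \<open>x\<close>\<close>
  define z where "z = m + x * sqrt V"
  note approx = descent_count_normal_approximation[OF sites n1, folded m_def, folded V_def]
  have V: "V > 0" by (rule approx(1))
  have mean: "des_mean n D = m / 2"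
    unfolding des_mean_def expectation_eq_avg[OF finite_D nonempty] m_def avg_mult_left descent_count_eq_des by simp
  have var: "des_var n D = V / 4"
  proof -
    have "des_var n D = avg D (\<lambda>s. (descent_count n s - m / 2)\<^sup>2)"
      unfolding des_var_def expectation_eq_avg[OF finite_D nonempty] descent_count_eq_des
      using mean unfolding des_mean_def expectation_eq_avg[OF finite_D nonempty] by (simp only:)
    also have "\<dots> = avg D (\<lambda>s. (2 * descent_count n s - m)\<^sup>2 / 4)"
      by (intro avg_cong) (simp add: power2_eq_square field_simps)
    finally show ?thesis by (simp add: avg_divide V_def)
  qed
  have "cdf (des_std_law n D) x = avg D (\<lambda>s. of_bool (2 * descent_count n s \<le> z))"
    unfolding cdf_des_std_law[OF finite_D nonempty]
  proof (rule avg_cong, rule arg_cong[where f = of_bool])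
    fix s
    have half: "sqrt (V / 4) = sqrt V / 2" by (simp add: real_sqrt_divide)
    have iff: "(d - m / 2) / (w / 2) \<le> x \<longleftrightarrow> 2 * d \<le> m + x * w" if "w > 0" for d w :: real
    proof -
      have "(d - m / 2) / (w / 2) \<le> x \<longleftrightarrow> d - m / 2 \<le> x * (w / 2)"
        using that by (intro pos_divide_le_eq) simp
      also have "x * (w / 2) = x * w / 2" by simp
      finally show ?thesis by auto
    qed
    show "(real (des n s) - des_mean n D) / sqrt (des_var n D) \<le> x \<longleftrightarrow> 2 * descent_count n s \<le> z"
      unfolding mean var z_def descent_count_eq_des half by (rule iff) (use V in simp)
  qed
  moreover have "(z - m) / sqrt V = x" using V by (simp add: z_def)
  ultimately show ?thesis using approx(2)[of z] unfolding Phi_def by simp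
qed

theorem theorem1p2:
  fixes lam mu :: "nat \<Rightarrow> nat list" and D :: "nat \<Rightarrow> (nat \<Rightarrow> nat) set"
  assumes "\<And>n. is_partition n (lam n)"
    and "\<And>n. is_partition n (mu n)"
    and "(\<lambda>n. real (length (lam n))) \<in> o(\<lambda>n. real n)"
    and "\<And>n. D n \<in> double_cosets n (lam n) (mu n)"
  shows "(\<lambda>n. kolmogorov_dist (des_std_law n (D n)) std_normal_distribution)
           \<in> O(\<lambda>n. real n powr (- 1 / 2)) \<and>
         weak_conv_m (\<lambda>n. des_std_law n (D n)) std_normal_distribution"
proof -
  have "eventually (\<lambda>n. real (length (lam n)) \<le> 1 / 72 * real n) at_top"
    using landau_o.smallD[OF assms(3), of "1 / 72"] by simp
  then have ev: "eventually (\<lambda>n. \<forall>x. \<bar>cdf (des_std_law n (D n)) x - cdf std_normal_distribution x\<bar>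
      \<le> 3000000000 / sqrt (real n)) at_top"
    using eventually_ge_at_top[of 40]
  proof eventually_elim
    case (elim n)
    then have "real (72 * length (lam n)) \<le> real n" by simp
    then have few: "72 * length (lam n) \<le> n" by (simp only: of_nat_le_iff)
    show ?case
      by (intro allI double_coset_normal_approximation[OF assms(1,2,4) few elim(2)])
  qed
  have "eventually (\<lambda>n. norm (kolmogorov_dist (des_std_law n (D n)) std_normal_distribution)
      \<le> 3000000000 * norm (real n powr (- 1 / 2))) at_top"
    using ev eventually_ge_at_top[of 1]
  proof eventually_elim
    case (elim n)
    let ?d = "\<lambda>x. \<bar>cdf (des_std_law n (D n)) x - cdf std_normal_distribution x\<bar>"
    have "kolmogorov_dist (des_std_law n (D n)) std_normal_distribution \<le> 3000000000 / sqrt (real n)"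
      unfolding kolmogorov_dist_def using elim by (intro cSUP_least) auto
    moreover have "?d 0 \<le> kolmogorov_dist (des_std_law n (D n)) std_normal_distribution"
      unfolding kolmogorov_dist_def using elim by (intro cSUP_upper bdd_aboveI2) auto
    moreover have "real n powr (- 1 / 2) = 1 / sqrt (real n)"
    proof -
      have "real n powr (- 1 / 2) = real n powr - (1 / 2)" by simp
      also have "\<dots> = 1 / real n powr (1 / 2)" by (rule powr_minus_divide)
      also have "real n powr (1 / 2) = sqrt (real n)" by (rule powr_half_sqrt) simp
      finally show ?thesis .
    qed
    ultimately show ?case by simp
  qed
  then have "(\<lambda>n. kolmogorov_dist (des_std_law n (D n)) std_normal_distribution)
      \<in> O(\<lambda>n. real n powr (- 1 / 2))"
    by (rule bigoI)
  moreover have "weak_conv_m (\<lambda>n. des_std_law n (D n)) std_normal_distribution"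
    unfolding weak_conv_m_def weak_conv_def
  proof (intro allI impI)
    fix x
    have "(\<lambda>n. 3000000000 / sqrt (real n)) \<longlonglongrightarrow> 0"
      by real_asymp
    moreover have "eventually (\<lambda>n. norm (cdf (des_std_law n (D n)) x - cdf std_normal_distribution x)
        \<le> 3000000000 / sqrt (real n)) at_top"
      using ev by eventually_elim simp
    ultimately have "(\<lambda>n. cdf (des_std_law n (D n)) x - cdf std_normal_distribution x) \<longlonglongrightarrow> 0"
      by (rule Lim_null_comparison[rotated])
    then show "(\<lambda>n. cdf (des_std_law n (D n)) x) \<longlonglongrightarrow> cdf std_normal_distribution x"
      by (simp add: LIM_zero_iff)
  qed
  ultimately show ?thesis by blast
qed

end
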